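(* Let $y=(y_{ij})_{i,j\ge0,\,i+j\le4}$ be a real bivariate truncated moment sequence of degree $4$, with second order moment matrix $M_2(y)$. If $M_2(y)$ is positive definite, then $y$ has a representing measure.
   Context: $M_2(y)$ is the $6\times 6$ real symmetric matrix with rows and columns indexed by $\alpha,\beta\in\mathbb{Z}_+^2$ with $|\alpha|,|\beta|\le2$, and $(\alpha,\beta)$ entry $y_{\alpha+\beta}$. A representing measure for $y$ is a positive Borel measure $\mu$ on $\mathbb{R}^2$ such that $y_{ij}=\int_{\mathbb{R}^2}x_1^ix_2^j\,d\mu(x)$ for all $i,j\ge 0$ with $i+j\le4$. *)

theory Defs
  imports "HOL-Analysis.Analysis"
begin

text \<open>
  A truncated moment sequence is a function \<open>y\<close> on pairs of naturals. A sequence of degree 4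
  consists of the values \<open>y (i, j)\<close> with \<open>i + j \<le> 4\<close>; the definitions below look at no others.
\<close>

typedef midx2 = "{\<alpha> :: nat \<times> nat. fst \<alpha> + snd \<alpha> \<le> 2}"
  morphisms exps Abs_midx2
  by (rule exI[of _ "(0, 0)"]) simp

lemma midx2_set_eq:
  "{\<alpha> :: nat \<times> nat. fst \<alpha> + snd \<alpha> \<le> 2} = {(0,0), (1,0), (0,1), (2,0), (1,1), (0,2)}"
proof -
  have "i \<le> 2 \<and> j \<le> 2 \<Longrightarrow> i \<in> {0,1,2} \<and> j \<in> {0,1,2}" for i j :: nat
    by auto
  then show ?thesis by fastforce
qed

instance midx2 :: finite
proof
  have "finite (Abs_midx2 ` {\<alpha>. fst \<alpha> + snd \<alpha> \<le> 2})"
    unfolding midx2_set_eq by (intro finite_imageI) simp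
  then show "finite (UNIV :: midx2 set)"
    unfolding type_definition.Abs_image[OF type_definition_midx2] .
qed

lemma card_midx2: "CARD(midx2) = 6"
  using type_definition.card[OF type_definition_midx2] by (simp add: midx2_set_eq)

definition moment_matrix2 :: "(nat \<times> nat \<Rightarrow> real) \<Rightarrow> real ^ midx2 ^ midx2" where
  "moment_matrix2 y = (\<chi> \<alpha> \<beta>. y (exps \<alpha> + exps \<beta>))"

definition positive_definite :: "real ^ 'n ^ 'n \<Rightarrow> bool" where
  "positive_definite A \<longleftrightarrow>
     transpose A = A \<and> (\<forall>v. v \<noteq> 0 \<longrightarrow> v \<bullet> (A *v v) > 0)"

text \<open>
  Integrability has to be demanded separately, because the Bochner integral of a non-integrable
  function is 0 by convention. At \<open>i = j = 0\<close> it makes \<open>\<mu>\<close> finite.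
\<close>

definition representing_measure4 :: "(nat \<times> nat \<Rightarrow> real) \<Rightarrow> (real ^ 2) measure \<Rightarrow> bool" where
  "representing_measure4 y \<mu> \<longleftrightarrow>
     sets \<mu> = sets borel \<and>
     (\<forall>i j. i + j \<le> 4 \<longrightarrow>
        integrable \<mu> (\<lambda>x. (x $ 1) ^ i * (x $ 2) ^ j) \<and>
        y (i, j) = (\<integral>x. (x $ 1) ^ i * (x $ 2) ^ j \<partial>\<mu>))"

end

theory Submission
  imports Defs
begin

text \<open>
  Write \<open>L\<close> for the linear functional on polynomials of degree at most 4 that sends a monomial to its
  prescribed moment. That the moment matrix is positive definite means \<open>L (q\<^sup>2) > 0\<close> for every
  nonzero polynomial \<open>q\<close> of degree at most 2. If \<open>L\<close> is even positive on all nonzero polynomials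
  that are nonnegative on the plane, then the moment vector lies in the convex cone generated by the vectors
  of monomials evaluated at points: a hyperplane separating it from that cone would be a nonzero polynomial,
  nonnegative at every point, with \<open>L \<le> 0\<close>. Membership in the cone is a finitely atomic
  representing measure.

  The bridge from squares to nonnegative polynomials is \<open>ternary_quartic_dominates_square\<close>, the heart
  of Hilbert's theorem that nonnegative ternary quartic forms are sums of squares: a nonzero nonnegative quartic
  \<open>p\<close> satisfies \<open>q\<^sup>2 \<le> p\<close> for some nonzero quadratic \<open>q\<close>. It yields positivity as follows
  (\<open>positive_on_squares_imp_positive_on_nonneg\<close>). If \<open>L p \<le> 0\<close>, minimise \<open>L\<close> over the compact set of
  all polynomials \<open>r\<close> with \<open>0 \<le> r \<le> p\<close>. From a nonzero minimiser a square \<open>q\<^sup>2\<close> can be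
  subtracted without leaving the set, which lowers \<open>L\<close> strictly; and if the minimiser is \<open>0\<close>, then
  the same step applied to \<open>p\<close> gives a value below \<open>L p \<le> 0\<close>, again a contradiction.

  To find \<open>q\<close>, follow Choi and Lam. A form without zeros is bounded below by a positive
  multiple of the fourth power of a coordinate, by compactness of the sphere. Otherwise move a zero to \<open>(1, 0, 0)\<close>; the form becomes
  \<open>F = x\<^sup>2 f\<^sub>2 + 2 x f\<^sub>3 + f\<^sub>4\<close> with forms \<open>f\<^sub>k\<close> of degree \<open>k\<close> in the other two variables,
  \<open>f\<^sub>2 \<ge> 0\<close> and \<open>f\<^sub>3\<^sup>2 \<le> f\<^sub>2 f\<^sub>4\<close>. Completing the square,
  \<open>f\<^sub>2 F = (x f\<^sub>2 + f\<^sub>3)\<^sup>2 + (f\<^sub>2 f\<^sub>4 - f\<^sub>3\<^sup>2)\<close>,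
  reduces everything to binary forms. There nonnegativity is strong: a nonnegative binary form is divisible
  by the square of a linear form through any of its zeros. Each zero that spoils a compactness argument
  thus splits off a linear factor, and after at most two such factors \<open>q\<close> can be written down.
\<close>

section \<open>Homogeneous polynomial functions\<close>

text \<open>
  The polynomial functions that are homogeneous of degree \<open>n\<close>. Building them up by linear factors
  makes no reference to coordinates, so that invariance under linear substitutions is immediate.
\<close>

inductive form :: "nat \<Rightarrow> ('a::euclidean_space \<Rightarrow> real) \<Rightarrow> bool" where
  const: "form 0 (\<lambda>_. c)"
| linear_mult: "linear l \<Longrightarrow> form n f \<Longrightarrow> form (Suc n) (\<lambda>v. l v * f v)"
| add: "form n f \<Longrightarrow> form n g \<Longrightarrow> form n (\<lambda>v. f v + g v)"

lemma form_linear: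
  assumes "linear l"
  shows "form 1 l"
  using form.linear_mult[OF assms form.const[of 1]] by simp

lemma form_scale: "form n f \<Longrightarrow> form n (\<lambda>v. c * f v)"
proof (induction rule: form.induct)
  case (const d)
  show ?case by (rule form.const)
next
  case (linear_mult l n f)
  from form.linear_mult[OF linear_mult(1,3)] show ?case
    by (simp add: mult.left_commute)
next
  case (add n f g)
  from form.add[OF add(3,4)] show ?case
    by (simp add: distrib_left)
qed

lemma form_divide: "form n f \<Longrightarrow> form n (\<lambda>v. f v / c)"
  using form_scale[of n f "1 / c"] by simp

lemma form_diff: "form n f \<Longrightarrow> form n g \<Longrightarrow> form n (\<lambda>v. f v - g v)"
  using form.add[of n f "\<lambda>v. -1 * g v"] form_scale[of n g "-1"] by simp

lemma form_mult: "form m f \<Longrightarrow> form n g \<Longrightarrow> form (m + n) (\<lambda>v. f v * g v)"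
proof (induction rule: form.induct)
  case (const c)
  then show ?case by (simp add: form_scale)
next
  case (linear_mult l m f)
  from form.linear_mult[OF linear_mult(1) linear_mult(3)[OF linear_mult(4)]] show ?case
    by (simp add: mult.assoc)
next
  case (add m f h)
  from form.add[OF add(3)[OF add(5)] add(4)[OF add(5)]] show ?case
    by (simp add: distrib_right)
qed

lemma form_mult_eq: "form m f \<Longrightarrow> form n g \<Longrightarrow> k = m + n \<Longrightarrow> form k (\<lambda>v. f v * g v)"
  using form_mult by blast

lemma form_power: "linear l \<Longrightarrow> form n (\<lambda>v. l v ^ n)"
proof (induction n)
  case 0
  show ?case using form.const[of 1] by simp
next
  case (Suc n)
  then show ?case using form.linear_mult[of l n "\<lambda>v. l v ^ n"] by simp
qed

lemma form_sum:
  fixes f :: "'i \<Rightarrow> 'a::euclidean_space \<Rightarrow> real"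
  assumes "finite I" "\<And>i. i \<in> I \<Longrightarrow> form n (f i)"
  shows "form n (\<lambda>v. \<Sum>i\<in>I. f i v)"
  using assms
proof (induction rule: finite_induct)
  case empty
  have "form n (\<lambda>v::'a. 0 * (0::real) ^ n)"
    by (rule form_scale[OF form_power[of "\<lambda>_. 0"]]) (simp add: linear_zero)
  then show ?case by simp
next
  case (insert i I)
  then have "form n (\<lambda>v. f i v + (\<Sum>i\<in>I. f i v))"
    by (intro form.add) auto
  with insert show ?case by simp
qed

lemma form_compose:
  assumes "form n f" "linear A"
  shows "form n (\<lambda>v. f (A v))"
  using assms
proof (induction rule: form.induct)
  case (const c)
  show ?case by (rule form.const)
next
  case (linear_mult l n f)
  have "linear (\<lambda>v. l (A v))"
    using linear_compose[OF linear_mult(4,1)] by (simp add: o_def)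
  from form.linear_mult[OF this linear_mult(3)[OF linear_mult(4)]] show ?case .
next
  case (add n f g)
  then show ?case by (intro form.add)
qed

lemma form_continuous: "form n f \<Longrightarrow> continuous_on S f"
proof (induction rule: form.induct)
  case (linear_mult l n f)
  then show ?case
    by (intro continuous_on_mult) (simp_all add: linear_continuous_on linear_conv_bounded_linear)
qed (auto intro: continuous_on_add)

lemma form_scaleR: "form n f \<Longrightarrow> f (c *\<^sub>R v) = c ^ n * f v"
  by (induction rule: form.induct) (auto simp: linear_cmul algebra_simps)

lemma form_0_const:
  assumes "form 0 f"
  obtains c where "f = (\<lambda>_. c)"
proof -
  have "n = 0 \<longrightarrow> (\<exists>c. f = (\<lambda>_. c))" if "form n f" for n
    using that by (induction rule: form.induct) auto
  with assms that show thesis by blast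
qed

lemma form_1_linear:
  assumes "form 1 f"
  shows "linear f"
proof -
  have "n = 1 \<longrightarrow> linear f" if "form n f" for n
    using that
  proof (induction rule: form.induct)
    case (linear_mult l n f)
    show ?case
    proof
      assume "Suc n = 1"
      with linear_mult(2) have "form 0 f" by simp
      then obtain c where "f = (\<lambda>_. c)" by (rule form_0_const)
      then show "linear (\<lambda>v. l v * f v)"
        using linear_compose_scale_right[OF linear_mult(1), of c] by (simp add: mult.commute)
    qed
  next
    case (add n f g)
    then show ?case by (simp add: linear_compose_add)
  qed simp
  with assms show ?thesis by blast
qed

text \<open>
  Division by the first coordinate: the remainder no longer depends on it. Iterating this expands a form in
  powers of the first coordinate.
\<close>

lemma form_split:
  fixes f :: "real \<times> 'b::euclidean_space \<Rightarrow> real"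
  assumes "form (Suc n) f"
  obtains g where "form n g" "\<And>x w. f (x, w) = x * g (x, w) + f (0, w)"
proof -
  have "\<exists>g. form n g \<and> (\<forall>x w. f (x, w) = x * g (x, w) + f (0, w))"
    using assms
  proof (induction "Suc n" f arbitrary: n rule: form.induct)
    case (linear_mult l n f)
    have l0: "linear (\<lambda>v::real \<times> 'b. l (0, snd v))"
      using linear_compose[OF _ linear_mult(1), of "\<lambda>v. (0, snd v)"]
      by (simp add: o_def linear_iff)
    have l: "l (x, w) = x * l (1, 0) + l (0, w)" for x w
      using linear_add[OF linear_mult(1), of "x *\<^sub>R (1, 0)" "(0, w)"]
        linear_cmul[OF linear_mult(1), of x "(1, 0)"] by simp
    show ?case
    proof (cases n)
      case 0
      with linear_mult(2) have "form 0 f" by simp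
      then obtain c where c: "f = (\<lambda>_. c)" by (rule form_0_const)
      have "l (x, w) * f (x, w) = x * (l (1, 0) * c) + l (0, w) * f (0, w)" for x w
        unfolding c l[of x w] by algebra
      then show ?thesis
        unfolding 0 by (intro exI[of _ "\<lambda>_. l (1, 0) * c"] conjI allI form.const)
    next
      case (Suc m)
      from linear_mult(3)[OF Suc] obtain g where g: "form m g"
        "\<And>x w. f (x, w) = x * g (x, w) + f (0, w)" by blast
      have "form n (\<lambda>v. l (1, 0) * f v + l (0, snd v) * g v)"
        using linear_mult(2) form.linear_mult[OF l0 g(1)] Suc
        by (intro form.add form_scale) auto
      moreover have "l (x, w) * f (x, w)
          = x * (l (1, 0) * f (x, w) + l (0, snd (x, w)) * g (x, w)) + l (0, w) * f (0, w)" for x w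
        unfolding snd_conv using l[of x w] g(2)[of x w] by algebra
      ultimately show ?thesis by (intro exI[of _ "\<lambda>v. l (1, 0) * f v + l (0, snd v) * g v"] conjI allI)
    qed
  next
    case (add f g)
    from add(2,4) obtain f' g' where
      "form n f'" "\<And>x w. f (x, w) = x * f' (x, w) + f (0, w)"
      "form n g'" "\<And>x w. g (x, w) = x * g' (x, w) + g (0, w)" by blast
    note fg = this
    have "f (x, w) + g (x, w) = x * (f' (x, w) + g' (x, w)) + (f (0, w) + g (0, w))" for x w
      using fg(2,4)[of x w] by algebra
    with form.add[OF fg(1,3)] show ?case
      by (intro exI[of _ "\<lambda>v. f' v + g' v"] conjI allI)
  qed
  with that show thesis by blast
qed

text \<open>
  On the unit sphere the quotient of \<open>g\<close> by \<open>f\<close> is bounded, and both sides scale alike.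
\<close>

lemma positive_form_dominates_form:
  assumes "form (Suc n) f" "form (Suc n) g" and pos: "\<And>v. v \<noteq> 0 \<Longrightarrow> 0 < f v"
  obtains \<epsilon> where "\<epsilon> > 0" "\<And>v. \<epsilon> * g v \<le> f v"
proof -
  have "sphere (0::'a) 1 \<noteq> {}" by simp
  with continuous_attains_inf[OF compact_sphere this form_continuous[OF assms(1)]]
  obtain u where u: "norm u = 1" "\<And>v. norm v = 1 \<Longrightarrow> f u \<le> f v" by auto
  have "bounded (g ` sphere 0 1)"
    by (intro compact_imp_bounded compact_continuous_image form_continuous[OF assms(2)] compact_sphere)
  then obtain M where M: "M > 0" "\<And>v. norm v = 1 \<Longrightarrow> \<bar>g v\<bar> \<le> M"
    unfolding bounded_pos by auto
  have fu: "f u > 0" using u(1) by (intro pos) auto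
  show thesis
  proof (rule that[of "f u / M"])
    show "f u / M > 0" using fu M by simp
    fix v
    show "f u / M * g v \<le> f v"
    proof (cases "v = 0")
      case True
      then show ?thesis
        using form_scaleR[OF assms(1), of 0 0] form_scaleR[OF assms(2), of 0 0] by simp
    next
      case False
      define s where "s = v /\<^sub>R norm v"
      have s: "norm s = 1" using False by (simp add: s_def)
      have v: "v = norm v *\<^sub>R s" using False by (simp add: s_def)
      have "f u / M * g s \<le> f u / M * M"
        using M(2)[OF s] fu M(1) by (intro mult_left_mono) auto
      also have "\<dots> \<le> f s" using M(1) u(2)[OF s] by simp
      finally have "norm v ^ Suc n * (f u / M * g s) \<le> norm v ^ Suc n * f s"
        by (intro mult_left_mono) auto
      then show ?thesis
        using form_scaleR[OF assms(1), of "norm v" s] form_scaleR[OF assms(2), of "norm v" s] v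
        by (simp add: mult.left_commute)
    qed
  qed
qed

text \<open>
  This replaces first order conditions at a minimum: when \<open>t * h t\<close> is nonnegative, \<open>h\<close> changes
  sign at \<open>0\<close>.
\<close>

lemma eq_0_if_sign_change:
  fixes h :: "real \<Rightarrow> real"
  assumes "continuous_on UNIV h" "\<And>t. 0 \<le> t * h t"
  shows "h 0 = 0"
proof (rule antisym)
  have "(h \<longlongrightarrow> h 0) (at 0)"
    using assms(1) by (simp add: continuous_on_eq_continuous_at isCont_def)
  then have right: "(h \<longlongrightarrow> h 0) (at_right 0)" and left: "(h \<longlongrightarrow> h 0) (at_left 0)"
    by (auto simp: filterlim_at_split)
  have "0 \<le> h t" if "0 < t" for t
    using assms(2)[of t] that by (simp add: zero_le_mult_iff)
  then show "0 \<le> h 0"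
    by (intro tendsto_lowerbound[OF right]) (auto simp: eventually_at_filter)
  have "h t \<le> 0" if "t < 0" for t
    using assms(2)[of t] that by (auto simp: zero_le_mult_iff)
  then show "h 0 \<le> 0"
    by (intro tendsto_upperbound[OF left]) (auto simp: eventually_at_filter)
qed

text \<open>
  The zero set of a nonzero linear functional has dense complement, so inequalities of continuous functions may
  be divided by the square of the functional.
\<close>

lemma nonneg_cancel_square:
  fixes h :: "'a::euclidean_space \<Rightarrow> real"
  assumes "linear l" "l d \<noteq> 0" "continuous_on UNIV h" "\<And>v. 0 \<le> (l v)\<^sup>2 * h v"
  shows "0 \<le> h v"
proof (cases "l v = 0")
  case False
  then show ?thesis using assms(4)[of v] by (simp add: zero_le_mult_iff)
next
  case True
  have "0 \<le> h (v + t *\<^sub>R d)" if "t \<noteq> 0" for t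
  proof -
    have "l (v + t *\<^sub>R d) \<noteq> 0"
      using True that assms(2) by (simp add: linear_add[OF assms(1)] linear_cmul[OF assms(1)])
    then show ?thesis using assms(4)[of "v + t *\<^sub>R d"] by (simp add: zero_le_mult_iff)
  qed
  moreover have "((\<lambda>t. h (v + t *\<^sub>R d)) \<longlongrightarrow> h (v + 0 *\<^sub>R d)) (at 0)"
  proof -
    have "continuous_on UNIV (\<lambda>t. h (v + t *\<^sub>R d))"
      by (rule continuous_on_compose2[OF assms(3)]) (auto intro!: continuous_intros)
    then have "isCont (\<lambda>t. h (v + t *\<^sub>R d)) 0"
      by (simp add: continuous_on_eq_continuous_at)
    then show ?thesis by (simp only: isCont_def)
  qed
  ultimately have "0 \<le> h (v + 0 *\<^sub>R d)"
    by (intro tendsto_lowerbound[where F = "at (0::real)"]) (auto simp: eventually_at_filter)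
  then show ?thesis by simp
qed

section \<open>Zeros of forms on the plane\<close>

text \<open>
  The linear form, unique up to scaling, that vanishes on the line through the origin and \<open>p\<close>.
\<close>

definition line_through :: "real \<times> real \<Rightarrow> real \<times> real \<Rightarrow> real" where
  "line_through p w = snd p * fst w - fst p * snd w"

lemma linear_line_through: "linear (line_through p)"
  by (rule linearI) (simp_all add: line_through_def algebra_simps)

lemma line_through_nonzero:
  assumes "p \<noteq> 0"
  obtains d where "line_through p d > 0" "\<And>t. line_through p (p + t *\<^sub>R d) = t * line_through p d"
proof (rule that[of "(snd p, - fst p)"])
  have "fst p \<noteq> 0 \<or> snd p \<noteq> 0" using assms by (auto simp: prod_eq_iff)
  then have "0 < (fst p)\<^sup>2 + (snd p)\<^sup>2" by (simp only: sum_power2_gt_zero_iff)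
  then show "line_through p (snd p, - fst p) > 0"
    by (simp add: line_through_def power2_eq_square add.commute)
  show "line_through p (p + t *\<^sub>R (snd p, - fst p)) = t * line_through p (snd p, - fst p)" for t
    by (simp add: line_through_def algebra_simps)
qed

text \<open>
  A rotation and scaling turns \<open>p\<close> into \<open>(0, 1)\<close>, and then the remainder in the division by the
  first coordinate is the value at \<open>p\<close> times a power of the second coordinate.
\<close>

lemma form_factor_line:
  assumes f: "form (Suc n) f" and p: "f p = 0" "p \<noteq> 0"
  obtains g where "form n g" "\<And>w. f w = line_through p w * g w"
proof -
  define N where "N = (fst p)\<^sup>2 + (snd p)\<^sup>2"
  define A where "A w = (snd p * fst w + fst p * snd w, snd p * snd w - fst p * fst w)" for w :: "real \<times> real"
  define B where "B u = (line_through p u / N, (fst p * fst u + snd p * snd u) / N)" for u :: "real \<times> real"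
  have N: "N \<noteq> 0"
    using p(2) by (simp add: N_def prod_eq_iff)
  have A: "linear A" by (rule linearI) (simp_all add: A_def algebra_simps)
  have B: "linear B"
    by (rule linearI) (simp_all add: B_def line_through_def algebra_simps add_divide_distrib diff_divide_distrib)
  have AB: "A (B u) = u" for u
  proof -
    have "snd p * line_through p u + fst p * (fst p * fst u + snd p * snd u) = fst u * N"
      "snd p * (fst p * fst u + snd p * snd u) - fst p * line_through p u = snd u * N"
      unfolding N_def line_through_def by algebra+
    then have "A (line_through p u, fst p * fst u + snd p * snd u) = N *\<^sub>R u"
      by (simp add: A_def prod_eq_iff mult.commute)
    moreover have "B u = (1 / N) *\<^sub>R (line_through p u, fst p * fst u + snd p * snd u)"
      by (simp add: B_def)
    ultimately have "A (B u) = (1 / N) *\<^sub>R (N *\<^sub>R u)"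
      by (simp only: linear_cmul[OF A])
    then show ?thesis using N by simp
  qed
  obtain g where g: "form n g" "\<And>x y. f (A (x, y)) = x * g (x, y) + f (A (0, y))"
    by (rule form_split[OF form_compose[OF f A]], rule that)
  have "A (0, y) = y *\<^sub>R p" for y by (simp add: A_def prod_eq_iff)
  then have "f (A (0, y)) = 0" for y
    using form_scaleR[OF f, of y p] p(1) by simp
  with g(2) have fA: "f (A v) = fst v * g v" for v
    by (metis add_0_right prod.collapse)
  show thesis
  proof (rule that)
    show "form n (\<lambda>u. g (B u) / N)"
      by (intro form_divide form_compose[OF g(1) B])
    show "f u = line_through p u * (g (B u) / N)" for u
      using fA[of "B u"] unfolding AB by (simp add: B_def)
  qed
qed

text \<open>
  Along a line crossing the zero transversally, a simple linear factor would change sign; hence the cofactor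
  vanishes at \<open>p\<close> as well and can be factored once more.
\<close>

lemma nonneg_form_factor_line_square:
  assumes f: "form (Suc (Suc n)) f" and nonneg: "\<And>w. 0 \<le> f w" and p: "f p = 0" "p \<noteq> 0"
  obtains g where "form n g" "\<And>w. f w = (line_through p w)\<^sup>2 * g w" "\<And>w. 0 \<le> g w"
proof -
  obtain h where h: "form (Suc n) h" "\<And>w. f w = line_through p w * h w"
    using form_factor_line[OF f p] by blast
  obtain d where d: "line_through p d > 0" "\<And>t. line_through p (p + t *\<^sub>R d) = t * line_through p d"
    using line_through_nonzero[OF p(2)] by blast
  have "continuous_on UNIV (\<lambda>t. line_through p d * h (p + t *\<^sub>R d))"
    by (intro continuous_on_mult continuous_on_compose2[OF form_continuous[OF h(1), of UNIV]] continuous_intros) auto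
  moreover have "0 \<le> t * (line_through p d * h (p + t *\<^sub>R d))" for t
    using nonneg[of "p + t *\<^sub>R d"] by (simp add: h(2) d(2) mult.assoc)
  ultimately have "line_through p d * h (p + 0 *\<^sub>R d) = 0"
    by (rule eq_0_if_sign_change)
  with d(1) have "h p = 0" by simp
  then obtain g where g: "form n g" "\<And>w. h w = line_through p w * g w"
    using form_factor_line[OF h(1) _ p(2)] by blast
  have fg: "f w = (line_through p w)\<^sup>2 * g w" for w
    by (simp add: h(2) g(2) power2_eq_square)
  have "0 \<le> g w" for w
    using nonneg_cancel_square[OF linear_line_through _ form_continuous[OF g(1)], of p d w] d(1) nonneg
    by (simp add: fg)
  with g(1) fg that show thesis by blast
qed

section \<open>Squares below nonnegative forms\<close>

text \<open>
  One step towards a sum of squares: the nonzero square of a form of degree \<open>d\<close> can be subtracted from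
  \<open>F\<close> without destroying nonnegativity.
\<close>

definition dominates_square :: "nat \<Rightarrow> ('a::euclidean_space \<Rightarrow> real) \<Rightarrow> bool" where
  "dominates_square d F \<longleftrightarrow> (\<exists>q. form d q \<and> (\<exists>v. q v \<noteq> 0) \<and> (\<forall>v. (q v)\<^sup>2 \<le> F v))"

lemma dominates_squareI:
  "form d q \<Longrightarrow> q v \<noteq> 0 \<Longrightarrow> (\<And>v. (q v)\<^sup>2 \<le> F v) \<Longrightarrow> dominates_square d F"
  unfolding dominates_square_def by blast

lemma dominates_square_substitution:
  assumes "linear A" "linear B" "\<And>v. A (B v) = v" "\<And>v. B (A v) = v"
    and "dominates_square d (\<lambda>v. F (A v))"
  shows "dominates_square d F"
proof -
  obtain q v where q: "form d q" "q v \<noteq> 0" "\<And>v. (q v)\<^sup>2 \<le> F (A v)"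
    using assms(5) unfolding dominates_square_def by blast
  show ?thesis
  proof (rule dominates_squareI)
    show "form d (\<lambda>v. q (B v))" by (rule form_compose[OF q(1) assms(2)])
    show "q (B (A v)) \<noteq> 0" using q(2) assms(4) by simp
    show "(q (B v))\<^sup>2 \<le> F v" for v using q(3)[of "B v"] assms(3) by simp
  qed
qed

text \<open>
  Any form of degree \<open>d\<close> will do after scaling; a power of a coordinate is the simplest choice.
\<close>

lemma positive_form_dominates_square:
  fixes F :: "'a::euclidean_space \<Rightarrow> real"
  assumes F: "form (2 * d) F" and "0 < d" and pos: "\<And>v. v \<noteq> 0 \<Longrightarrow> 0 < F v"
  shows "dominates_square d F"
proof -
  obtain b :: 'a where b: "b \<in> Basis" using nonempty_Basis by blast
  have lin: "linear (\<lambda>v. v \<bullet> b)" by (rule linearI) (simp_all add: inner_add_left)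
  obtain k where k: "2 * d = Suc k" using \<open>0 < d\<close> by (cases "2 * d") auto
  obtain e where e: "e > 0" "\<And>v. e * (v \<bullet> b) ^ (2 * d) \<le> F v"
    using positive_form_dominates_form[OF F[unfolded k] form_power[OF lin] pos] unfolding k by blast
  show ?thesis
  proof (rule dominates_squareI)
    show "form d (\<lambda>v. sqrt e * (v \<bullet> b) ^ d)"
      by (intro form_scale form_power lin)
    show "sqrt e * (b \<bullet> b) ^ d \<noteq> 0" using e(1) b by (simp add: inner_Basis)
    show "(sqrt e * (v \<bullet> b) ^ d)\<^sup>2 \<le> F v" for v
      using e(1) e(2)[of v]
      by (simp add: power_mult_distrib power_mult[symmetric] mult.commute)
  qed
qed

lemma dominates_square_line_mult:
  assumes "dominates_square d h" "p \<noteq> 0" "\<And>w. f w = (line_through p w)\<^sup>2 * h w"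
  shows "dominates_square (Suc d) f"
proof -
  obtain q v where q: "form d q" "q v \<noteq> 0" "\<And>v. (q v)\<^sup>2 \<le> h v"
    using assms(1) unfolding dominates_square_def by blast
  obtain e where e: "line_through p e \<noteq> 0"
    using line_through_nonzero[OF assms(2)] by (metis less_irrefl)
  have "\<exists>w. line_through p w * q w \<noteq> 0"
  proof (rule ccontr)
    assume "\<not> ?thesis"
    then have "line_through p w = 0 \<or> q w = 0" for w by (cases w) auto
    then have "0 \<le> (line_through p w)\<^sup>2 * - (q w)\<^sup>2" for w
      by (metis mult_zero_left mult_zero_right neg_0_equal_iff_equal order_refl zero_power2)
    moreover have "continuous_on UNIV (\<lambda>w. - (q w)\<^sup>2)"
      by (intro continuous_intros form_continuous[OF q(1)])
    ultimately have "0 \<le> - (q v)\<^sup>2"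
      using nonneg_cancel_square[OF linear_line_through e] by blast
    with q(2) show False by simp
  qed
  then obtain w where "line_through p w * q w \<noteq> 0" by blast
  moreover have "form (Suc d) (\<lambda>w. line_through p w * q w)"
    by (intro form.linear_mult linear_line_through q)
  moreover have "(line_through p w * q w)\<^sup>2 \<le> f w" for w
    using q(3)[of w] by (simp add: assms(3) power_mult_distrib mult_left_mono)
  ultimately show ?thesis by (intro dominates_squareI)
qed

text \<open>
  Induction on \<open>d\<close>: either there is no zero, or the square of a linear form splits off and the
  cofactor is a nonnegative form of smaller degree.
\<close>

lemma binary_form_dominates_square:
  fixes f :: "real \<times> real \<Rightarrow> real"
  assumes "form (2 * d) f" "\<And>w. 0 \<le> f w" "f v \<noteq> 0"
  shows "dominates_square d f"
  using assms
proof (induction d arbitrary: f v)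
  case 0
  then have "form 0 f" by simp
  then obtain c where c: "f = (\<lambda>_. c)" by (rule form_0_const)
  with 0 have "0 < c" by (simp add: less_le)
  then show ?case
    using form.const[of "sqrt c"] by (intro dominates_squareI[of 0 "\<lambda>_. sqrt c" v]) (auto simp: c)
next
  case (Suc d)
  show ?case
  proof (cases "\<exists>p. p \<noteq> 0 \<and> f p = 0")
    case False
    then show ?thesis
      using Suc.prems by (intro positive_form_dominates_square) (auto simp: less_le)
  next
    case True
    then obtain p where p: "f p = 0" "p \<noteq> 0" by blast
    obtain h where h: "form (2 * d) h" "\<And>w. f w = (line_through p w)\<^sup>2 * h w" "\<And>w. 0 \<le> h w"
      using nonneg_form_factor_line_square[of "2 * d" f, OF _ Suc.prems(2) p] Suc.prems(1) by auto
    have "h v \<noteq> 0" using Suc.prems(3) h(2) by auto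
    from Suc.IH[OF h(1,3) this] p(2) h(2) show ?thesis by (rule dominates_square_line_mult)
  qed
qed

section \<open>Nonnegative ternary quartics\<close>

lemma nonneg_quadratic_coefficients:
  fixes a b c :: real
  assumes nonneg: "\<And>x. 0 \<le> x\<^sup>2 * a + 2 * x * b + c"
  shows "0 \<le> a" "0 \<le> c" "b\<^sup>2 \<le> a * c"
proof -
  show c: "0 \<le> c" using nonneg[of 0] by simp
  show a: "0 \<le> a"
  proof (rule ccontr)
    assume "\<not> 0 \<le> a"
    then have a: "a < 0" by simp
    \<comment> \<open>The vertex value is \<open>k\<close>; moving away from the vertex by \<open>s\<close> lowers it by \<open>\<bar>k\<bar> + 1\<close>.\<close>
    define r k s where "r = b / a" and "k = c - r\<^sup>2 * a" and "s = sqrt ((\<bar>k\<bar> + 1) / - a)"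
    have b: "b = r * a" using a by (simp add: r_def)
    have "s\<^sup>2 = (\<bar>k\<bar> + 1) / - a"
      unfolding s_def using a by (intro real_sqrt_pow2 divide_nonneg_nonneg) auto
    then have "s\<^sup>2 * a = - (\<bar>k\<bar> + 1)" using a by simp
    moreover have "(s - r)\<^sup>2 * a + 2 * (s - r) * b + c = s\<^sup>2 * a + k"
      unfolding k_def b by algebra
    ultimately show False using nonneg[of "s - r"] by linarith
  qed
  show "b\<^sup>2 \<le> a * c"
  proof (cases "a = 0")
    case True
    have "b = 0"
    proof (rule ccontr)
      assume "b \<noteq> 0"
      then have "2 * (- (c + 1) / (2 * b)) * b = - (c + 1)" by simp
      then show False using nonneg[of "- (c + 1) / (2 * b)"] True by simp
    qed
    then show ?thesis using True by simp
  next
    case False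
    define r where "r = b / a"
    have b: "b = r * a" using False by (simp add: r_def)
    have "(- r)\<^sup>2 * a + 2 * - r * b + c = c - r\<^sup>2 * a" unfolding b by algebra
    with nonneg[of "- r"] have "r\<^sup>2 * a \<le> c" by linarith
    then have "a * (r\<^sup>2 * a) \<le> a * c" using a by (rule mult_left_mono)
    then show ?thesis by (simp add: b power2_eq_square mult.assoc mult.left_commute)
  qed
qed

lemma form_linear_mult_eq: "linear l \<Longrightarrow> form n f \<Longrightarrow> k = Suc n \<Longrightarrow> form k (\<lambda>v. l v * f v)"
  using form.linear_mult by blast

text \<open>
  At a zero of a nonnegative form the gradient vanishes, which removes the terms of degree 4 and 3 in the
  first variable.
\<close>

lemma quartic_vanishing_at_axis:
  fixes F :: "real \<times> 'b::euclidean_space \<Rightarrow> real"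
  assumes F: "form 4 F" and nonneg: "\<And>v. 0 \<le> F v" and zero: "F (1, 0) = 0"
  obtains f2 f3 f4 where "form 2 f2" "form 3 f3" "form 4 f4"
    "\<And>x w. F (x, w) = x\<^sup>2 * f2 w + 2 * x * f3 w + f4 w"
proof -
  have restrict: "form n (\<lambda>w. g (0, w))" if "form n g" for n and g :: "real \<times> 'b \<Rightarrow> real"
    by (rule form_compose[OF that]) (simp add: linear_iff)
  have split: "\<exists>g. form n g \<and> (\<forall>x w. f (x, w) = x * g (x, w) + f (0, w))"
    if "form k f" "k = Suc n" for k n and f :: "real \<times> 'b \<Rightarrow> real"
    using form_split[of n f] that by metis
  have deg: "(4::nat) = Suc 3" "(3::nat) = Suc 2" "(2::nat) = Suc 1" "(1::nat) = Suc 0"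
    by simp_all
  obtain g3 where g3: "form 3 g3" "\<And>x w. F (x, w) = x * g3 (x, w) + F (0, w)"
    using split[OF F deg(1)] by blast
  obtain g2 where g2: "form 2 g2" "\<And>x w. g3 (x, w) = x * g2 (x, w) + g3 (0, w)"
    using split[OF g3(1) deg(2)] by blast
  obtain g1 where g1: "form 1 g1" "\<And>x w. g2 (x, w) = x * g1 (x, w) + g2 (0, w)"
    using split[OF g2(1) deg(3)] by blast
  obtain g0 where "form 0 g0" and g0: "\<And>x w. g1 (x, w) = x * g0 (x, w) + g1 (0, w)"
    using split[OF g1(1) deg(4)] by blast
  from this(1) obtain c where c: "g0 = (\<lambda>_. c)" by (rule form_0_const)
  have expand: "F (x, w) = x^4 * c + x^3 * g1 (0, w) + x\<^sup>2 * g2 (0, w) + x * g3 (0, w) + F (0, w)" for x w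
  proof -
    have "F (x, w) = x * (x * (x * (x * c + g1 (0, w)) + g2 (0, w)) + g3 (0, w)) + F (0, w)"
      by (simp only: g3(2)[of x w] g2(2)[of x w] g1(2)[of x w] g0[of x w] c)
    also have "\<dots> = x^4 * c + x^3 * g1 (0, w) + x\<^sup>2 * g2 (0, w) + x * g3 (0, w) + F (0, w)"
      by algebra
    finally show ?thesis .
  qed
  have at0: "f (0, 0) = 0" if "form n f" "0 < n" for n and f :: "real \<times> 'b \<Rightarrow> real"
    using form_scaleR[OF that(1), of 0 0] that(2) by (simp add: zero_prod_def power_0_left)
  have "c = 0"
    using expand[of 1 0] zero at0[OF g1(1)] at0[OF g2(1)] at0[OF g3(1)] at0[OF F] by simp
  have "g1 (0, w) = 0" for w
  proof -
    let ?h = "\<lambda>t. g1 (0, w) + t * g2 (0, w) + t\<^sup>2 * g3 (0, w) + t^3 * F (0, w)"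
    have "F (1, t *\<^sub>R w) = t * ?h t" for t
    proof -
      have "(0, t *\<^sub>R w) = t *\<^sub>R (0, w)" by simp
      then have sc: "f (0, t *\<^sub>R w) = t ^ n * f (0, w)" if "form n f" for n and f :: "real \<times> 'b \<Rightarrow> real"
        using form_scaleR[OF that] by metis
      have "F (1, t *\<^sub>R w) = t ^ 1 * g1 (0, w) + t\<^sup>2 * g2 (0, w) + t ^ 3 * g3 (0, w) + t ^ 4 * F (0, w)"
        unfolding expand[of 1] sc[OF g1(1)] sc[OF g2(1)] sc[OF g3(1)] sc[OF F] \<open>c = 0\<close> by simp
      then show ?thesis by (simp add: eval_nat_numeral algebra_simps)
    qed
    then have "0 \<le> t * ?h t" for t using nonneg[of "(1, t *\<^sub>R w)"] by simp
    moreover have "continuous_on UNIV ?h" by (intro continuous_intros)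
    ultimately have "?h 0 = 0" by (rule eq_0_if_sign_change[rotated])
    then show ?thesis by simp
  qed
  then have "F (x, w) = x\<^sup>2 * g2 (0, w) + 2 * x * (g3 (0, w) / 2) + F (0, w)" for x w
    using expand[of x w] \<open>c = 0\<close> by simp
  moreover have "form 2 (\<lambda>w. g2 (0, w))" "form 3 (\<lambda>w. g3 (0, w) / 2)" "form 4 (\<lambda>w. F (0, w))"
    using restrict[OF g2(1)] restrict[OF g3(1)] restrict[OF F]
    by (auto intro: form_divide)
  ultimately show thesis using that by blast
qed

text \<open>
  If the coefficient of \<open>x\<^sup>2\<close> has a zero, then with the line \<open>l\<close> through this zero it is
  \<open>a l\<^sup>2\<close>, and the discriminant inequality forces \<open>l\<close> to divide \<open>f\<^sub>3 = l g\<close>, leaving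
  \<open>g\<^sup>2 \<le> a f\<^sub>4\<close>. So \<open>a F = (a x l + g)\<^sup>2 + (a f\<^sub>4 - g\<^sup>2)\<close> exhibits the square if
  \<open>a > 0\<close>; for \<open>a = 0\<close> the form does not involve \<open>x\<close> at all.
\<close>

lemma dominates_square_if_leading_form_degenerate:
  fixes f2 f3 f4 :: "real \<times> real \<Rightarrow> real"
  defines "F \<equiv> \<lambda>v. (fst v)\<^sup>2 * f2 (snd v) + 2 * fst v * f3 (snd v) + f4 (snd v)"
  assumes forms: "form 2 f2" "form 3 f3" "form 4 f4"
    and nonneg: "\<And>v. 0 \<le> F v" and "F v0 \<noteq> 0" and p: "f2 p = 0" "p \<noteq> 0"
  shows "dominates_square 2 F"
proof -
  have "0 \<le> x\<^sup>2 * f2 w + 2 * x * f3 w + f4 w" for x w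
    using nonneg[of "(x, w)"] by (simp add: F_def)
  from nonneg_quadratic_coefficients[OF this]
  have f2: "0 \<le> f2 w" and f4: "0 \<le> f4 w" and disc: "(f3 w)\<^sup>2 \<le> f2 w * f4 w" for w by blast+
  have "form (Suc (Suc 0)) f2" "form (Suc 2) f3" using forms by (simp_all add: eval_nat_numeral)
  note forms' = this
  obtain a' where a': "form 0 a'" "\<And>w. f2 w = (line_through p w)\<^sup>2 * a' w" "\<And>w. 0 \<le> a' w"
    using nonneg_form_factor_line_square[OF forms'(1) f2 p] by blast
  from a'(1) obtain a where "a' = (\<lambda>_. a)" by (rule form_0_const)
  with a' have a: "f2 w = (line_through p w)\<^sup>2 * a" "0 \<le> a" for w by auto
  have "f3 p = 0" using disc[of p] p(1) by simp
  then obtain g where g: "form 2 g" "\<And>w. f3 w = line_through p w * g w"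
    using form_factor_line[OF forms'(2) _ p(2)] by blast
  obtain d where d: "line_through p d \<noteq> 0"
    using line_through_nonzero[OF p(2)] by (metis less_irrefl)
  have ineq: "0 \<le> a * f4 w - (g w)\<^sup>2" for w
  proof (rule nonneg_cancel_square[OF linear_line_through d])
    show "continuous_on UNIV (\<lambda>w. a * f4 w - (g w)\<^sup>2)"
      by (intro continuous_intros form_continuous[OF forms(3)] form_continuous[OF g(1)])
    show "0 \<le> (line_through p w)\<^sup>2 * (a * f4 w - (g w)\<^sup>2)" for w
      using disc[of w] by (simp add: a g algebra_simps)
  qed
  show ?thesis
  proof (cases "a = 0")
    case True
    with ineq have "g w = 0" for w using zero_le_power2[of "g w"] by (simp add: order_antisym)
    with True have F: "F v = f4 (snd v)" for v by (simp add: F_def a g)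
    with \<open>F v0 \<noteq> 0\<close> have "f4 (snd v0) \<noteq> 0" by simp
    with forms(3) f4 have "dominates_square 2 f4"
      by (intro binary_form_dominates_square[of 2 f4 "snd v0"]) simp_all
    then obtain q v where q: "form 2 q" "q v \<noteq> 0" "\<And>v. (q v)\<^sup>2 \<le> f4 v"
      unfolding dominates_square_def by blast
    show ?thesis
      by (rule dominates_squareI[of 2 "\<lambda>v. q (snd v)" "(0, v)"])
        (auto simp: F q intro!: form_compose[OF q(1)] linear_snd)
  next
    case False
    with a(2) have a0: "0 < a" by simp
    define q where "q v = (a * (fst v * line_through p (snd v)) + g (snd v)) / sqrt a" for v
    have "form 2 (\<lambda>v. fst v * line_through p (snd v))"
      by (rule form_linear_mult_eq[OF linear_fst form_compose[OF form_linear[OF linear_line_through] linear_snd]]) simp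
    then have q: "form 2 q"
      unfolding q_def by (intro form_divide form.add form_scale form_compose[OF g(1)] linear_snd)
    have "q (1, d) - q (0, d) = a * line_through p d / sqrt a"
      by (simp add: q_def diff_divide_distrib[symmetric])
    also have "\<dots> \<noteq> 0" using a0 d by simp
    finally have "q (1, d) \<noteq> 0 \<or> q (0, d) \<noteq> 0" by auto
    moreover have "(q v)\<^sup>2 \<le> F v" for v
    proof -
      have "a * F v = (a * (fst v * line_through p (snd v)) + g (snd v))\<^sup>2 + (a * f4 (snd v) - (g (snd v))\<^sup>2)"
        unfolding F_def a g by algebra
      with ineq[of "snd v"] have "(a * (fst v * line_through p (snd v)) + g (snd v))\<^sup>2 \<le> F v * a"
        by (simp add: mult.commute)
      then show ?thesis using a0 by (simp add: q_def power_divide pos_divide_le_eq)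
    qed
    ultimately show ?thesis using dominates_squareI[OF q] by blast
  qed
qed

text \<open>
  The terminal case of the reduction, with lines \<open>l\<close> and \<open>k\<close>:
  \<open>F = x\<^sup>2 f\<^sub>2 + 2 x l k m + n l\<^sup>2 k\<^sup>2\<close>. The square is read off from
  \<open>n F = (n l k + x m)\<^sup>2 + x\<^sup>2 (n f\<^sub>2 - m\<^sup>2)\<close> if \<open>n > 0\<close>. If \<open>n = 0\<close>, then \<open>m = 0\<close>
  and \<open>F = x\<^sup>2 f\<^sub>2\<close>.
\<close>

lemma dominates_square_two_lines:
  fixes f2 m :: "real \<times> real \<Rightarrow> real" and p r :: "real \<times> real" and n :: real
  defines "F \<equiv> \<lambda>v. (fst v)\<^sup>2 * f2 (snd v) + 2 * fst v * (line_through p (snd v) * line_through r (snd v) * m (snd v))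
      + n * (line_through p (snd v) * line_through r (snd v))\<^sup>2"
  assumes f2: "form 2 f2" "\<And>w. w \<noteq> 0 \<Longrightarrow> 0 < f2 w" and m: "form 1 m"
    and "p \<noteq> 0" "r \<noteq> 0" and disc: "\<And>w. 0 \<le> n * f2 w - (m w)\<^sup>2"
  shows "dominates_square 2 F"
proof -
  have n: "0 \<le> n"
  proof -
    have "0 \<le> n * f2 p" using disc[of p] zero_le_power2[of "m p"] by linarith
    with f2(2)[OF \<open>p \<noteq> 0\<close>] show ?thesis by (simp add: zero_le_mult_iff)
  qed
  have lin: "linear (\<lambda>v::real\<times>real\<times>real. line_through p (snd v))" for p
    using linear_compose[OF linear_snd linear_line_through] by (simp add: o_def)
  have linm: "linear (\<lambda>v::real\<times>real\<times>real. m (snd v))"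
    using linear_compose[OF linear_snd form_1_linear[OF m]] by (simp add: o_def)
  show ?thesis
  proof (cases "n = 0")
    case False
    with n have n0: "0 < n" by simp
    define q where "q v = (n * (line_through p (snd v) * line_through r (snd v)) + fst v * m (snd v)) / sqrt n" for v
    have q: "form 2 q"
      unfolding q_def
      by (intro form_divide form.add form_scale form_linear_mult_eq lin linear_fst)
        (simp_all add: form_linear[OF lin, simplified] form_linear[OF linm, simplified])
    \<comment> \<open>The product of two nonzero linear forms is nonzero; multiplying a dominated square by a line gives this.\<close>
    obtain d where d: "line_through p d * line_through r d \<noteq> 0"
    proof -
      obtain w where "line_through r w \<noteq> 0" using line_through_nonzero[OF \<open>r \<noteq> 0\<close>] by (metis less_irrefl)
      then have "dominates_square (Suc 1) (\<lambda>w. (line_through p w)\<^sup>2 * (line_through r w)\<^sup>2)"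
        using \<open>p \<noteq> 0\<close>
        by (intro dominates_square_line_mult[of 1 "\<lambda>w. (line_through r w)\<^sup>2"]
            dominates_squareI[of 1 "line_through r" w])
        (auto simp: form_linear[OF linear_line_through, simplified])
      then obtain q :: "real \<times> real \<Rightarrow> real" and v where "q v \<noteq> 0"
         "(q v)\<^sup>2 \<le> (line_through p v)\<^sup>2 * (line_through r v)\<^sup>2"
        unfolding dominates_square_def by blast
      moreover from \<open>q v \<noteq> 0\<close> have "0 < (q v)\<^sup>2" by simp
      ultimately have "0 < (line_through p v)\<^sup>2 * (line_through r v)\<^sup>2" by linarith
      then show thesis by (intro that[of v]) auto
    qed
    have "q (0, d) \<noteq> 0" using d n0 by (simp add: q_def)
    moreover have "(q v)\<^sup>2 \<le> F v" for v
    proof -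
      have "n * F v = (n * (line_through p (snd v) * line_through r (snd v)) + fst v * m (snd v))\<^sup>2
          + (fst v)\<^sup>2 * (n * f2 (snd v) - (m (snd v))\<^sup>2)"
        unfolding F_def by algebra
      with mult_nonneg_nonneg[OF zero_le_power2 disc, of "fst v" "snd v"]
      have "(n * (line_through p (snd v) * line_through r (snd v)) + fst v * m (snd v))\<^sup>2 \<le> F v * n"
        by (simp add: mult.commute)
      then show ?thesis using n0 by (simp add: q_def power_divide pos_divide_le_eq)
    qed
    ultimately show ?thesis using dominates_squareI[OF q] by blast
  next
    case True
    then have m0: "m w = 0" for w using disc[of w] by simp
    have "dominates_square 1 f2"
      using f2 by (intro positive_form_dominates_square) auto
    then obtain q v where q: "form 1 q" "q v \<noteq> 0" "\<And>v. (q v)\<^sup>2 \<le> f2 v"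
      unfolding dominates_square_def by blast
    show ?thesis
    proof (rule dominates_squareI)
      show "form 2 (\<lambda>v. fst v * q (snd v))"
        by (rule form_linear_mult_eq[OF linear_fst form_compose[OF q(1) linear_snd]]) simp
      show "fst (1, v) * q (snd (1::real, v)) \<noteq> 0" using q(2) by simp
      show "(fst v * q (snd v))\<^sup>2 \<le> F v" for v
        using q(3)[of "snd v"] by (simp add: F_def m0 True power_mult_distrib mult_left_mono)
    qed
  qed
qed

text \<open>
  The shape \<open>F = x\<^sup>2 f\<^sub>2 + 2 x l g\<^sub>2 + l\<^sup>2 g\<^sub>3\<close> arises when \<open>F\<close> has a second zero
  \<open>(0, p)\<close>, with \<open>l\<close> the line through \<open>p\<close>. Its discriminant is \<open>l\<^sup>2 E\<close> with \<open>E = f\<^sub>2 g\<^sub>3 - g\<^sub>2\<^sup>2\<close>. If \<open>E\<close> has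
  no zero, compactness gives \<open>F \<ge> \<epsilon> l\<^sup>4\<close>. If it has one, the substitution
  \<open>x \<mapsto> x + \<alpha> l\<close>, which keeps \<open>E\<close>, can be chosen so that \<open>g\<^sub>2\<close> and \<open>g\<^sub>3\<close> both
  vanish there, and a second line splits off.
\<close>

lemma dominates_square_common_line:
  fixes f2 g2 g3 :: "real \<times> real \<Rightarrow> real" and p :: "real \<times> real"
  defines "F \<equiv> \<lambda>v. (fst v)\<^sup>2 * f2 (snd v) + 2 * fst v * (line_through p (snd v) * g2 (snd v))
      + (line_through p (snd v))\<^sup>2 * g3 (snd v)"
  assumes f2: "form 2 f2" "\<And>w. w \<noteq> 0 \<Longrightarrow> 0 < f2 w" and g: "form 2 g2" "form 2 g3"
    and p: "p \<noteq> 0" and nonneg: "\<And>v. 0 \<le> F v"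
  shows "dominates_square 2 F"
proof -
  let ?l = "line_through p"
  obtain d where d: "?l d \<noteq> 0"
    using line_through_nonzero[OF p] by (metis less_irrefl)
  define E where "E w = f2 w * g3 w - (g2 w)\<^sup>2" for w
  have E: "form 4 E"
    unfolding E_def power2_eq_square by (intro form_diff form_mult_eq[OF f2(1) g(2)] form_mult_eq[OF g(1) g(1)]) simp_all
  have "0 \<le> (?l w)\<^sup>2 * E w" for w
  proof -
    have "0 \<le> x\<^sup>2 * f2 w + 2 * x * (?l w * g2 w) + (?l w)\<^sup>2 * g3 w" for x
      using nonneg[of "(x, w)"] by (simp add: F_def)
    from nonneg_quadratic_coefficients(3)[OF this] show ?thesis by (simp add: E_def algebra_simps)
  qed
  then have E_nonneg: "0 \<le> E w" for w
    by (rule nonneg_cancel_square[OF linear_line_through d form_continuous[OF E]])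
  show ?thesis
  proof (cases "\<exists>r. r \<noteq> 0 \<and> E r = 0")
    case False
    then have E_pos: "0 < E w" if "w \<noteq> 0" for w
      using that E_nonneg[of w] by (metis less_le)
    have "form (Suc 3) (\<lambda>w. f2 w * (?l w)\<^sup>2)"
      by (rule form_mult_eq[OF f2(1) form_power[OF linear_line_through]]) simp
    moreover have "form (Suc 3) E" using E by simp
    ultimately obtain e where e: "0 < e" "\<And>w. e * (f2 w * (?l w)\<^sup>2) \<le> E w"
      using positive_form_dominates_form E_pos by blast
    have bound: "e * (?l w)^4 \<le> F (x, w)" for x w
    proof (cases "w = 0")
      case True
      then have "?l w = 0" by (simp add: line_through_def)
      then show ?thesis using nonneg[of "(x, w)"] by simp
    next
      case False
      have "f2 w * F (x, w) = (x * f2 w + ?l w * g2 w)\<^sup>2 + (?l w)\<^sup>2 * E w"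
        unfolding F_def E_def fst_conv snd_conv by algebra
      moreover have "(?l w)\<^sup>2 * (e * (f2 w * (?l w)\<^sup>2)) \<le> (?l w)\<^sup>2 * E w"
        by (intro mult_left_mono e) simp
      ultimately have "(?l w)\<^sup>2 * (e * (f2 w * (?l w)\<^sup>2)) \<le> f2 w * F (x, w)"
        using zero_le_power2[of "x * f2 w + ?l w * g2 w"] by linarith
      moreover have "(?l w)\<^sup>2 * (e * (f2 w * (?l w)\<^sup>2)) = f2 w * (e * (?l w)^4)" by algebra
      ultimately show ?thesis using f2(2)[OF False] by simp
    qed
    show ?thesis
    proof (rule dominates_squareI)
      show "form 2 (\<lambda>v::real \<times> real \<times> real. sqrt e * (?l (snd v))\<^sup>2)"
        by (intro form_scale form_compose[OF form_power] linear_line_through linear_snd)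
      show "sqrt e * (?l (snd (0::real, d)))\<^sup>2 \<noteq> 0" using e d by simp
      show "(sqrt e * (?l (snd v))\<^sup>2)\<^sup>2 \<le> F v" for v
        using bound[of "snd v" "fst v"] e(1) by (simp add: power_mult_distrib power_mult[symmetric])
    qed
  next
    case True
    then obtain r where r: "r \<noteq> 0" "E r = 0" by blast
    \<comment> \<open>The coefficients after replacing \<open>x\<close> by \<open>x + \<alpha> l\<close>, where \<open>\<alpha>\<close> is chosen to make \<open>g2\<close> vanish at \<open>r\<close>.\<close>
    define \<alpha> where "\<alpha> = - g2 r / f2 r"
    define g2' where "g2' w = g2 w + \<alpha> * f2 w" for w
    define g3' where "g3' w = g3 w + 2 * \<alpha> * g2 w + \<alpha>\<^sup>2 * f2 w" for w
    have "form 2 g2'" "form 2 g3'"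
      unfolding g2'_def g3'_def by (intro form.add form_scale f2(1) g)+
    then have forms': "form (Suc 1) g2'" "form (Suc (Suc 0)) g3'" by (simp_all add: eval_nat_numeral)
    have E': "E w = f2 w * g3' w - (g2' w)\<^sup>2" for w
      unfolding E_def g2'_def g3'_def by algebra
    have "g2' r = 0" using f2(2)[OF r(1)] by (simp add: g2'_def \<alpha>_def)
    then obtain m where m: "form 1 m" "\<And>w. g2' w = line_through r w * m w"
      using form_factor_line[OF forms'(1) _ r(1)] by blast
    have "g3' r = 0" using E'[of r] r f2(2)[OF r(1)] \<open>g2' r = 0\<close> by simp
    have "0 \<le> g3' w" for w
    proof (cases "w = 0")
      case True
      then show ?thesis using form_scaleR[OF forms'(2), of 0 0] by simp
    next
      case False
      have "0 \<le> f2 w * g3' w" using E'[of w] E_nonneg[of w] zero_le_power2[of "g2' w"] by linarith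
      with f2(2)[OF False] show ?thesis by (simp add: zero_le_mult_iff)
    qed
    then obtain n' where n': "form 0 n'" "\<And>w. g3' w = (line_through r w)\<^sup>2 * n' w"
      using nonneg_form_factor_line_square[OF forms'(2) _ \<open>g3' r = 0\<close> r(1)] by blast
    from n'(1) obtain n where "n' = (\<lambda>_. n)" by (rule form_0_const)
    with n'(2) have n: "g3' w = (line_through r w)\<^sup>2 * n" for w by simp
    obtain d' where d': "line_through r d' \<noteq> 0"
      using line_through_nonzero[OF r(1)] by (metis less_irrefl)
    have disc: "0 \<le> n * f2 w - (m w)\<^sup>2" for w
    proof (rule nonneg_cancel_square[OF linear_line_through d'])
      show "continuous_on UNIV (\<lambda>w. n * f2 w - (m w)\<^sup>2)"
        by (intro continuous_intros form_continuous[OF f2(1)] form_continuous[OF m(1)])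
      show "0 \<le> (line_through r w)\<^sup>2 * (n * f2 w - (m w)\<^sup>2)" for w
        using E_nonneg[of w] unfolding E' m(2) n by (simp add: algebra_simps)
    qed
    define A where "A s v = (fst v + s * ?l (snd v), snd v)" for s and v :: "real \<times> real \<times> real"
    have A: "linear (A s)" for s
      unfolding A_def by (rule linearI) (simp_all add: line_through_def algebra_simps)
    have FA: "F (A \<alpha> v) = (fst v)\<^sup>2 * f2 (snd v) + 2 * fst v * (?l (snd v) * line_through r (snd v) * m (snd v))
      + n * (?l (snd v) * line_through r (snd v))\<^sup>2" for v
    proof -
      have "F (A \<alpha> v) = (fst v)\<^sup>2 * f2 (snd v) + 2 * fst v * (?l (snd v) * g2' (snd v)) + (?l (snd v))\<^sup>2 * g3' (snd v)"
        unfolding F_def A_def g2'_def g3'_def fst_conv snd_conv by algebra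
      then show ?thesis unfolding m(2) n by (simp add: power_mult_distrib mult_ac)
    qed
    show ?thesis
    proof (rule dominates_square_substitution)
      show "dominates_square 2 (\<lambda>v. F (A \<alpha> v))"
        unfolding FA by (rule dominates_square_two_lines[OF f2 m(1) p r(1) disc])
      show "A \<alpha> (A (- \<alpha>) v) = v" "A (- \<alpha>) (A \<alpha> v) = v" for v by (simp_all add: A_def)
    qed (rule A)+
  qed
qed

text \<open>
  Now the discriminant \<open>D = f\<^sub>2 f\<^sub>4 - f\<^sub>3\<^sup>2\<close> decides. If it has no zero, it dominates a
  multiple of \<open>f\<^sub>2\<^sup>3\<close>, hence \<open>F\<close> a multiple of \<open>f\<^sub>2\<^sup>2\<close>. A zero \<open>p\<close> of \<open>D\<close>
  gives a zero \<open>(- f\<^sub>3 p / f\<^sub>2 p, p)\<close> of \<open>F\<close>; shearing it to \<open>(0, p)\<close> makes the line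
  through \<open>p\<close> divide \<open>f\<^sub>3\<close> once and \<open>f\<^sub>4\<close> twice.
\<close>

lemma dominates_square_if_leading_form_definite:
  fixes f2 f3 f4 :: "real \<times> real \<Rightarrow> real"
  defines "F \<equiv> \<lambda>v. (fst v)\<^sup>2 * f2 (snd v) + 2 * fst v * f3 (snd v) + f4 (snd v)"
  assumes forms: "form 2 f2" "form 3 f3" "form 4 f4"
    and f2: "\<And>w. w \<noteq> 0 \<Longrightarrow> 0 < f2 w" and nonneg: "\<And>v. 0 \<le> F v"
  shows "dominates_square 2 F"
proof -
  define D where "D w = f2 w * f4 w - (f3 w)\<^sup>2" for w
  have D: "form 6 D"
    unfolding D_def power2_eq_square
    by (intro form_diff form_mult_eq[OF forms(1,3)] form_mult_eq[OF forms(2) forms(2)]) simp_all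
  have D_nonneg: "0 \<le> D w" for w
  proof -
    have "0 \<le> x\<^sup>2 * f2 w + 2 * x * f3 w + f4 w" for x
      using nonneg[of "(x, w)"] by (simp add: F_def)
    from nonneg_quadratic_coefficients(3)[OF this] show ?thesis by (simp add: D_def)
  qed
  show ?thesis
  proof (cases "\<exists>p. p \<noteq> 0 \<and> D p = 0")
    case False
    then have D_pos: "0 < D w" if "w \<noteq> 0" for w
      using that D_nonneg[of w] by (metis less_le)
    have "form (Suc 5) (\<lambda>w. f2 w * (f2 w * f2 w))"
      by (rule form_mult_eq[OF forms(1) form_mult[OF forms(1) forms(1)]]) simp
    moreover have "form (Suc 5) D" using D by simp
    ultimately obtain e where e: "0 < e" "\<And>w. e * (f2 w * (f2 w * f2 w)) \<le> D w"
      using positive_form_dominates_form D_pos by blast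
    have bound: "e * (f2 w)\<^sup>2 \<le> F (x, w)" for x w
    proof (cases "w = 0")
      case True
      then have "f2 w = 0" using form_scaleR[OF forms(1), of 0 0] by simp
      then show ?thesis using nonneg[of "(x, w)"] by simp
    next
      case False
      have "f2 w * F (x, w) = (x * f2 w + f3 w)\<^sup>2 + D w"
        unfolding F_def D_def fst_conv snd_conv by algebra
      with e(2)[of w] have "e * (f2 w * (f2 w * f2 w)) \<le> f2 w * F (x, w)"
        using zero_le_power2[of "x * f2 w + f3 w"] by linarith
      moreover have "e * (f2 w * (f2 w * f2 w)) = f2 w * (e * (f2 w)\<^sup>2)" by algebra
      ultimately show ?thesis using f2[OF False] by simp
    qed
    have one: "f2 (1, 0) > 0" by (rule f2) (simp add: zero_prod_def)
    show ?thesis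
    proof (rule dominates_squareI)
      show "form 2 (\<lambda>v::real \<times> real \<times> real. sqrt e * f2 (snd v))"
        by (intro form_scale form_compose[OF forms(1)] linear_snd)
      show "sqrt e * f2 (snd (0::real, (1, 0))) \<noteq> 0" using e one by simp
      show "(sqrt e * f2 (snd v))\<^sup>2 \<le> F v" for v
        using bound[of "snd v" "fst v"] e(1) by (simp add: power_mult_distrib)
    qed
  next
    case True
    then obtain p where p: "p \<noteq> 0" "D p = 0" by blast
    \<comment> \<open>A linear shift with \<open>t p = - f3 p / f2 p\<close>; replacing \<open>x\<close> by \<open>x + t\<close> makes \<open>f3\<close> vanish at \<open>p\<close>.\<close>
    define t where "t w = - f3 p / f2 p * ((w \<bullet> p) / (p \<bullet> p))" for w
    have t: "linear t"
      by (rule linearI) (simp_all add: t_def inner_add_left algebra_simps add_divide_distrib diff_divide_distrib)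
    have tp: "t p = - f3 p / f2 p" using p(1) by (simp add: t_def)
    define f3' where "f3' w = f3 w + t w * f2 w" for w
    define f4' where "f4' w = f4 w + 2 * (t w * f3 w) + t w * (t w * f2 w)" for w
    have "form 3 f3'" "form 4 f4'"
      using forms unfolding f3'_def f4'_def
      by (intro form.add form_scale form_linear_mult_eq[OF t] | simp)+
    then have forms': "form (Suc 2) f3'" "form (Suc (Suc 2)) f4'" by (simp_all add: eval_nat_numeral)
    have f2p: "0 < f2 p" by (rule f2[OF p(1)])
    have f3'p: "f3' p = 0" using f2p by (simp add: f3'_def tp)
    have D': "D w = f2 w * f4' w - (f3' w)\<^sup>2" for w
      unfolding D_def f3'_def f4'_def by algebra
    have f4'p: "f4' p = 0" using D'[of p] p f2p f3'p by simp
    have f4'_nonneg: "0 \<le> f4' w" for w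
    proof -
      have "f4' w = F (t w, w)" by (simp add: f4'_def F_def power2_eq_square)
      with nonneg show ?thesis by simp
    qed
    obtain g2 where g2: "form 2 g2" "\<And>w. f3' w = line_through p w * g2 w"
      using form_factor_line[OF forms'(1) f3'p p(1)] by blast
    obtain g3 where g3: "form 2 g3" "\<And>w. f4' w = (line_through p w)\<^sup>2 * g3 w"
      using nonneg_form_factor_line_square[OF forms'(2) f4'_nonneg f4'p p(1)] by blast
    define A where "A s v = (fst v + s * t (snd v), snd v)" for s and v :: "real \<times> real \<times> real"
    have A: "linear (A s)" for s
      unfolding A_def by (rule linearI) (simp_all add: linear_add[OF t] linear_cmul[OF t] algebra_simps)
    have FA: "F (A 1 v) = (fst v)\<^sup>2 * f2 (snd v) + 2 * fst v * (line_through p (snd v) * g2 (snd v))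
      + (line_through p (snd v))\<^sup>2 * g3 (snd v)" for v
    proof -
      have "F (A 1 v) = (fst v)\<^sup>2 * f2 (snd v) + 2 * fst v * f3' (snd v) + f4' (snd v)"
        unfolding F_def A_def f3'_def f4'_def fst_conv snd_conv by algebra
      then show ?thesis unfolding g2(2) g3(2) .
    qed
    show ?thesis
    proof (rule dominates_square_substitution)
      show "dominates_square 2 (\<lambda>v. F (A 1 v))"
        unfolding FA
        by (rule dominates_square_common_line[OF forms(1) f2 g2(1) g3(1) p(1) nonneg[of "A 1 v" for v, unfolded FA]])
      show "A 1 (A (- 1) v) = v" "A (- 1) (A 1 v) = v" for v by (simp_all add: A_def)
    qed (rule A)+
  qed
qed

text \<open>
  What remains is to move a zero to the first axis by an invertible linear substitution.
\<close>

theorem ternary_quartic_dominates_square: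
  fixes F :: "real \<times> real \<times> real \<Rightarrow> real"
  assumes F: "form 4 F" and nonneg: "\<And>v. 0 \<le> F v" and nz: "F v0 \<noteq> 0"
  shows "dominates_square 2 F"
proof -
  have axis: "dominates_square 2 G"
    if G: "form 4 G" "\<And>v. 0 \<le> G v" "G v1 \<noteq> 0" "G (1, 0) = 0" for G :: "real \<times> real \<times> real \<Rightarrow> real" and v1
  proof -
    obtain f2 f3 f4 where f: "form 2 f2" "form 3 f3" "form 4 f4"
      and G_eq: "\<And>x w. G (x, w) = x\<^sup>2 * f2 w + 2 * x * f3 w + f4 w"
      using quartic_vanishing_at_axis[OF G(1,2,4)] by blast
    have G': "G = (\<lambda>v. (fst v)\<^sup>2 * f2 (snd v) + 2 * fst v * f3 (snd v) + f4 (snd v))"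
      using G_eq by (auto simp: fun_eq_iff)
    show ?thesis
    proof (cases "\<exists>p. p \<noteq> 0 \<and> f2 p = 0")
      case True
      then obtain p where "f2 p = 0" "p \<noteq> 0" by blast
      with f G(2,3) show ?thesis unfolding G' by (intro dominates_square_if_leading_form_degenerate)
    next
      case False
      have f2: "0 \<le> f2 w" for w
      proof -
        have "0 \<le> x\<^sup>2 * f2 w + 2 * x * f3 w + f4 w" for x
          using G(2)[of "(x, w)"] by (simp add: G_eq)
        then show ?thesis by (rule nonneg_quadratic_coefficients(1))
      qed
      from False have "0 < f2 w" if "w \<noteq> 0" for w using that f2[of w] by (metis less_le)
      with f G(2) show ?thesis unfolding G' by (intro dominates_square_if_leading_form_definite)
    qed
  qed
  show ?thesis
  proof (cases "\<exists>v. v \<noteq> 0 \<and> F v = 0")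
    case False
    then have "0 < F v" if "v \<noteq> 0" for v using nonneg[of v] that by (metis less_le)
    with F show ?thesis by (intro positive_form_dominates_square) auto
  next
    case True
    then obtain a p where v: "(a, p) \<noteq> 0" "F (a, p) = 0" by (metis prod.exhaust_sel)
    show ?thesis
    proof (cases "p = 0")
      case True
      with v have "a \<noteq> 0" by (auto simp: zero_prod_def)
      moreover have "F (a *\<^sub>R (1, 0)) = a ^ 4 * F (1, 0)" by (rule form_scaleR[OF F])
      ultimately have "F (1, 0) = 0" using v(2) True by simp
      from axis[OF F nonneg nz this] show ?thesis .
    next
      case False
      define N where "N = p \<bullet> p"
      have N: "N \<noteq> 0" using False by (simp add: N_def)
      \<comment> \<open>\<open>A\<close> sends the basis to \<open>(a, p)\<close>, to \<open>(0, p)\<close> rotated by a right angle, and to the old first axis.\<close>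
      define A :: "real \<times> real \<times> real \<Rightarrow> real \<times> real \<times> real" where
        "A v = (fst v * a + snd (snd v), fst v *\<^sub>R p + fst (snd v) *\<^sub>R (snd p, - fst p))" for v
      define B :: "real \<times> real \<times> real \<Rightarrow> real \<times> real \<times> real" where
        "B v = ((snd v \<bullet> p) / N, line_through p (snd v) / N, fst v - (snd v \<bullet> p) / N * a)" for v
      have A: "linear A"
        unfolding A_def by (rule linearI) (simp_all add: algebra_simps)
      have B: "linear B"
        unfolding B_def by (rule linearI)
         (simp_all add: inner_add_left linear_add[OF linear_line_through] linear_cmul[OF linear_line_through]
           add_divide_distrib algebra_simps)
      have BA: "B (A v) = v" for v
      proof -
        have "snd (A v) \<bullet> p = N * fst v" "line_through p (snd (A v)) = N * fst (snd v)"
          by (simp_all add: A_def N_def inner_prod_def line_through_def algebra_simps)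
        then show ?thesis using N by (simp add: B_def prod_eq_iff) (simp add: A_def)
      qed
      then have "B \<circ> A = id" by (simp add: fun_eq_iff)
      then have "A \<circ> B = id" using linear_inverse_left[OF A B] by simp
      then have AB: "A (B v) = v" for v by (metis comp_apply id_apply)
      show ?thesis
      proof (rule dominates_square_substitution[OF A B AB BA])
        show "dominates_square 2 (\<lambda>v. F (A v))"
        proof (rule axis)
          show "form 4 (\<lambda>v. F (A v))" by (rule form_compose[OF F A])
          show "F (A (B v0)) \<noteq> 0" using nz AB by simp
          show "F (A (1, 0)) = 0" using v by (simp add: A_def zero_prod_def[symmetric])
        qed (rule nonneg)
      qed
    qed
  qed
qed

section \<open>Polynomials as coefficient vectors\<close>

text \<open>
  Exponents of the monomials of degree at most 4. As a finite type they turn the polynomials of degree at most 4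
  into the Euclidean space \<open>real ^ midx4\<close>, where compactness and separation are available; a
  polynomial \<open>p\<close> has the value \<open>p \<bullet> monomials4 x\<close> at \<open>x\<close>, and the moment functional is the inner
  product with the vector of moments.
\<close>

typedef midx4 = "{\<alpha> :: nat \<times> nat. fst \<alpha> + snd \<alpha> \<le> 4}"
  morphisms exps4 Abs_midx4
  by (rule exI[of _ "(0, 0)"]) simp

lemma finite_exps4: "finite {\<alpha> :: nat \<times> nat. fst \<alpha> + snd \<alpha> \<le> 4}"
  by (rule finite_subset[of _ "{..4} \<times> {..4}"]) auto

instance midx4 :: finite
proof
  show "finite (UNIV :: midx4 set)"
    using finite_imageI[OF finite_exps4, of Abs_midx4]
    unfolding type_definition.Abs_image[OF type_definition_midx4] .
qed

lemma sum_midx2: "(\<Sum>\<alpha>\<in>UNIV. f (exps \<alpha>)) = sum f {(0,0), (1,0), (0,1), (2,0), (1,1), (0,2)}"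
proof -
  have "(\<Sum>\<alpha>\<in>UNIV. f (exps \<alpha>)) = sum f (range exps)"
    by (rule sum.reindex_cong[symmetric, where l = exps]) (auto simp: inj_on_def exps_inject)
  also have "range exps = {\<alpha>. fst \<alpha> + snd \<alpha> \<le> 2}"
    by (rule type_definition.Rep_range[OF type_definition_midx2])
  finally show ?thesis by (simp only: midx2_set_eq)
qed

lemma sum_midx4: "(\<Sum>\<gamma>\<in>UNIV. f (exps4 \<gamma>)) = (\<Sum>i\<le>4. \<Sum>j\<le>4. if i + j \<le> 4 then f (i, j) else 0)"
proof -
  have "(\<Sum>\<gamma>\<in>UNIV. f (exps4 \<gamma>)) = sum f (range exps4)"
    by (rule sum.reindex_cong[symmetric, where l = exps4]) (auto simp: inj_on_def exps4_inject)
  also have "range exps4 = {\<alpha>. fst \<alpha> + snd \<alpha> \<le> 4}"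
    by (rule type_definition.Rep_range[OF type_definition_midx4])
  also have "sum f \<dots> = (\<Sum>\<alpha>\<in>{..4} \<times> {..4}. if fst \<alpha> + snd \<alpha> \<le> 4 then f \<alpha> else 0)"
    by (rule sum.mono_neutral_cong_left) auto
  also have "\<dots> = (\<Sum>i\<le>4. \<Sum>j\<le>4. if i + j \<le> 4 then f (i, j) else 0)"
    unfolding sum.cartesian_product by (intro sum.cong) auto
  finally show ?thesis .
qed

definition monomial :: "real ^ 2 \<Rightarrow> nat \<times> nat \<Rightarrow> real" where
  "monomial x \<alpha> = (x $ 1) ^ fst \<alpha> * (x $ 2) ^ snd \<alpha>"

lemma monomial_add: "monomial x (\<alpha> + \<beta>) = monomial x \<alpha> * monomial x \<beta>"
  by (simp add: monomial_def power_add)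

definition monomials2 :: "real ^ 2 \<Rightarrow> real ^ midx2" where
  "monomials2 x = (\<chi> \<alpha>. monomial x (exps \<alpha>))"

definition monomials4 :: "real ^ 2 \<Rightarrow> real ^ midx4" where
  "monomials4 x = (\<chi> \<gamma>. monomial x (exps4 \<gamma>))"

text \<open>
  The coefficient vector of the square of the polynomial with coefficients \<open>v\<close>: every coefficient
  collects the pairs of exponents with the given sum.
\<close>

definition poly_square :: "real ^ midx2 \<Rightarrow> real ^ midx4" where
  "poly_square v = (\<chi> \<gamma>. \<Sum>p | Abs_midx4 (exps (fst p) + exps (snd p)) = \<gamma>. v $ fst p * v $ snd p)"

lemma exps4_Abs_add: "exps4 (Abs_midx4 (exps \<alpha> + exps \<beta>)) = exps \<alpha> + exps \<beta>"
  using exps[of \<alpha>] exps[of \<beta>] by (intro Abs_midx4_inverse) simp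

text \<open>
  Both evaluation at a point and the moment functional are inner products with a vector indexed by exponents,
  so this computes their values at a square.
\<close>

lemma poly_square_inner:
  "poly_square v \<bullet> (\<chi> \<gamma>. h (exps4 \<gamma>)) = (\<Sum>\<alpha>\<in>UNIV. \<Sum>\<beta>\<in>UNIV. v $ \<alpha> * v $ \<beta> * h (exps \<alpha> + exps \<beta>))"
proof -
  let ?add = "\<lambda>p. Abs_midx4 (exps (fst p) + exps (snd p))"
  let ?term = "\<lambda>p. v $ fst p * v $ snd p * h (exps (fst p) + exps (snd p))"
  have "poly_square v \<bullet> (\<chi> \<gamma>. h (exps4 \<gamma>))
      = (\<Sum>\<gamma>\<in>UNIV. \<Sum>p | ?add p = \<gamma>. v $ fst p * v $ snd p * h (exps4 \<gamma>))"
    by (simp add: inner_vec_def poly_square_def sum_distrib_right)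
  also have "\<dots> = (\<Sum>\<gamma>\<in>UNIV. \<Sum>p\<in>{p \<in> UNIV. ?add p = \<gamma>}. ?term p)"
    by (intro sum.cong) (auto simp: exps4_Abs_add)
  also have "\<dots> = (\<Sum>p\<in>UNIV. ?term p)"
    by (rule sum.group) auto
  also have "\<dots> = (\<Sum>\<alpha>\<in>UNIV. \<Sum>\<beta>\<in>UNIV. v $ \<alpha> * v $ \<beta> * h (exps \<alpha> + exps \<beta>))"
    by (simp add: sum.cartesian_product case_prod_beta)
  finally show ?thesis .
qed

lemma poly_square_monomials4: "poly_square v \<bullet> monomials4 x = (v \<bullet> monomials2 x)\<^sup>2"
  unfolding monomials4_def poly_square_inner[of v "monomial x"]
  by (simp add: monomials2_def inner_vec_def monomial_add power2_eq_square sum_product mult_ac)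

lemma poly_square_moments:
  "poly_square v \<bullet> (\<chi> \<gamma>. y (exps4 \<gamma>)) = v \<bullet> (moment_matrix2 y *v v)"
  unfolding poly_square_inner[of v y]
  by (simp add: inner_vec_def moment_matrix2_def matrix_vector_mult_def sum_distrib_left mult_ac)

text \<open>
  A polynomial that vanishes on the plane is zero, by applying the univariate fact in each variable.
\<close>

lemma inner_monomials4_eq_0:
  assumes "\<And>x. p \<bullet> monomials4 x = 0"
  shows "p = 0"
proof -
  define c where "c i j = (if i + j \<le> 4 then p $ Abs_midx4 (i, j) else 0)" for i j
  have eval: "p \<bullet> monomials4 (vector [s, t]) = (\<Sum>i\<le>4. (\<Sum>j\<le>4. c i j * t ^ j) * s ^ i)" for s t
  proof -
    define T where "T \<alpha> = p $ Abs_midx4 \<alpha> * (s ^ fst \<alpha> * t ^ snd \<alpha>)" for \<alpha>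
    have "p \<bullet> monomials4 (vector [s, t]) = (\<Sum>\<gamma>\<in>UNIV. T (exps4 \<gamma>))"
      by (simp add: inner_vec_def monomials4_def monomial_def exps4_inverse T_def)
    also have "\<dots> = (\<Sum>i\<le>4. \<Sum>j\<le>4. c i j * t ^ j * s ^ i)"
      unfolding sum_midx4 by (intro sum.cong refl) (simp add: c_def T_def)
    finally show ?thesis by (simp add: sum_distrib_right)
  qed
  have "(\<Sum>j\<le>4. c i j * t ^ j) = 0" if "i \<le> 4" for i t
  proof -
    have "\<forall>s. (\<Sum>i\<le>4. (\<Sum>j\<le>4. c i j * t ^ j) * s ^ i) = 0"
      using eval[of _ t] assms by metis
    with that show ?thesis unfolding polyfun_eq_0 by blast
  qed
  then have c0: "c i j = 0" if "i \<le> 4" "j \<le> 4" for i j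
    using that polyfun_eq_0[of "c i" 4] by blast
  have "p $ \<gamma> = 0" for \<gamma>
  proof -
    have "fst (exps4 \<gamma>) + snd (exps4 \<gamma>) \<le> 4" using exps4[of \<gamma>] by simp
    then have "c (fst (exps4 \<gamma>)) (snd (exps4 \<gamma>)) = p $ \<gamma>" by (simp add: c_def exps4_inverse)
    with c0[of "fst (exps4 \<gamma>)" "snd (exps4 \<gamma>)"] \<open>fst (exps4 \<gamma>) + snd (exps4 \<gamma>) \<le> 4\<close>
    show ?thesis by simp
  qed
  then show ?thesis by (simp add: vec_eq_iff)
qed

text \<open>
  The missing power of the third variable completes each monomial to degree 2, so that setting it to 1 gives
  the polynomial with coefficients \<open>w\<close>.
\<close>

lemma quadratic_form_coefficients:
  fixes q :: "real \<times> real \<times> real \<Rightarrow> real"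
  assumes "form 2 q"
  obtains w :: "real ^ midx2"
  where "\<And>x y z. q (x, y, z) = (\<Sum>\<alpha>\<in>UNIV. w $ \<alpha> * (x ^ fst (exps \<alpha>) * y ^ snd (exps \<alpha>) * z ^ (2 - fst (exps \<alpha>) - snd (exps \<alpha>))))"
proof -
  have two: "form (Suc 1) q" using assms by (simp add: eval_nat_numeral)
  obtain g where g: "form 1 g" "\<And>x v. q (x, v) = x * g (x, v) + q (0, v)"
    using form_split[OF two] by blast
  have "form (Suc 1) (\<lambda>v. q (0, v))"
    by (rule form_compose[OF two]) (simp add: linear_iff)
  then obtain h where h: "form 1 h" "\<And>y z. q (0, y, z) = y * h (y, z) + q (0, 0, z)"
    using form_split by blast
  have lin: "linear g" "linear h" using form_1_linear g(1) h(1) by blast+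
  have g3: "g (x, y, z) = x * g (1, 0, 0) + y * g (0, 1, 0) + z * g (0, 0, 1)" for x y z
    using linear_add[OF lin(1), of "x *\<^sub>R (1, 0, 0)" "y *\<^sub>R (0, 1, 0) + z *\<^sub>R (0, 0, 1)"]
      linear_add[OF lin(1), of "y *\<^sub>R (0, 1, 0)" "z *\<^sub>R (0, 0, 1)"]
      linear_cmul[OF lin(1), of x "(1, 0, 0)"] linear_cmul[OF lin(1), of y "(0, 1, 0)"]
      linear_cmul[OF lin(1), of z "(0, 0, 1)"] by simp
  have h2: "h (y, z) = y * h (1, 0) + z * h (0, 1)" for y z
    using linear_add[OF lin(2), of "y *\<^sub>R (1, 0)" "z *\<^sub>R (0, 1)"]
      linear_cmul[OF lin(2), of y "(1, 0)"] linear_cmul[OF lin(2), of z "(0, 1)"] by simp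
  have zz: "q (0, 0, z) = z\<^sup>2 * q (0, 0, 1)" for z
    using form_scaleR[OF assms, of z "(0, 0, 1)"] by simp
  define c :: "nat \<times> nat \<Rightarrow> real" where
    "c \<alpha> = (if \<alpha> = (2, 0) then g (1, 0, 0) else if \<alpha> = (1, 1) then g (0, 1, 0)
      else if \<alpha> = (1, 0) then g (0, 0, 1) else if \<alpha> = (0, 2) then h (1, 0)
      else if \<alpha> = (0, 1) then h (0, 1) else q (0, 0, 1))" for \<alpha>
  define T where "T x y z \<alpha> = c \<alpha> * (x ^ fst \<alpha> * y ^ snd \<alpha> * z ^ (2 - fst \<alpha> - snd \<alpha>))" for x y z \<alpha>
  show thesis
  proof (rule that[of "\<chi> \<alpha>. c (exps \<alpha>)"])
    fix x y z
    have "q (x, y, z) = x * (x * g (1, 0, 0) + y * g (0, 1, 0) + z * g (0, 0, 1))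
        + y * (y * h (1, 0) + z * h (0, 1)) + z\<^sup>2 * q (0, 0, 1)"
      by (simp only: g(2)[of x "(y, z)"] h(2)[of y z] zz[of z] g3[of x y z] h2[of y z] add.assoc)
    also have "\<dots> = (\<Sum>\<alpha>\<in>UNIV. T x y z (exps \<alpha>))"
      unfolding sum_midx2 by (simp add: c_def T_def power2_eq_square algebra_simps)
    finally show "q (x, y, z) = (\<Sum>\<alpha>\<in>UNIV. (\<chi> \<alpha>. c (exps \<alpha>)) $ \<alpha>
        * (x ^ fst (exps \<alpha>) * y ^ snd (exps \<alpha>) * z ^ (2 - fst (exps \<alpha>) - snd (exps \<alpha>))))"
      by (simp add: T_def)
  qed
qed

text \<open>
  Homogenisation: nonnegativity of \<open>p\<close> on the plane is nonnegativity of its form away from the line at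
  infinity, hence everywhere.
\<close>

lemma nonneg_quartic_ge_square:
  fixes p :: "real ^ midx4"
  assumes nonneg: "\<And>x. 0 \<le> p \<bullet> monomials4 x" and "p \<noteq> 0"
  obtains w where "w \<noteq> 0" "\<And>x. (w \<bullet> monomials2 x)\<^sup>2 \<le> p \<bullet> monomials4 x"
proof -
  define F :: "real \<times> real \<times> real \<Rightarrow> real" where
    "F v = (\<Sum>\<gamma>\<in>UNIV. p $ \<gamma> * (fst v ^ fst (exps4 \<gamma>) * fst (snd v) ^ snd (exps4 \<gamma>)
      * snd (snd v) ^ (4 - fst (exps4 \<gamma>) - snd (exps4 \<gamma>))))" for v
  have lin: "linear (\<lambda>v::real \<times> real \<times> real. fst (snd v))" "linear (\<lambda>v::real \<times> real \<times> real. snd (snd v))"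
    by (simp_all add: linear_iff)
  have monomial_form: "form (i + j + k) (\<lambda>v::real \<times> real \<times> real. fst v ^ i * fst (snd v) ^ j * snd (snd v) ^ k)" for i j k
    by (intro form_mult form_power linear_fst lin)
  have F: "form 4 F"
    unfolding F_def
  proof (intro form_sum form_scale)
    fix \<gamma>
    have deg: "fst (exps4 \<gamma>) + snd (exps4 \<gamma>) + (4 - fst (exps4 \<gamma>) - snd (exps4 \<gamma>)) = 4"
      using exps4[of \<gamma>] by simp
    show "form 4 (\<lambda>v::real \<times> real \<times> real. fst v ^ fst (exps4 \<gamma>)
        * fst (snd v) ^ snd (exps4 \<gamma>) * snd (snd v) ^ (4 - fst (exps4 \<gamma>) - snd (exps4 \<gamma>)))"
      using monomial_form[of "fst (exps4 \<gamma>)" "snd (exps4 \<gamma>)" "4 - fst (exps4 \<gamma>) - snd (exps4 \<gamma>)"]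
      unfolding deg .
  qed simp
  have F_affine: "F (x $ 1, x $ 2, 1) = p \<bullet> monomials4 x" for x :: "real ^ 2"
    by (simp add: F_def inner_vec_def monomials4_def monomial_def)
  have affine: "\<exists>x::real^2. F (a, b, c) = c ^ 4 * F (x $ 1, x $ 2, 1)" if "c \<noteq> 0" for a b c
  proof (intro exI[of _ "vector [a / c, b / c]"])
    show "F (a, b, c) = c ^ 4 * F ((vector [a / c, b / c] :: real ^ 2) $ 1, (vector [a / c, b / c] :: real ^ 2) $ 2, 1)"
      using form_scaleR[OF F, of c "(a / c, b / c, 1)"] that by simp
  qed
  have F_nonneg: "0 \<le> F v" for v
  proof (rule nonneg_cancel_square[OF lin(2) _ form_continuous[OF F]])
    show "snd (snd (0::real, 0::real, 1::real)) \<noteq> 0" by simp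
    show "0 \<le> (snd (snd v))\<^sup>2 * F v" for v
    proof (cases "snd (snd v) = 0")
      case False
      obtain a b c where v: "v = (a, b, c)" by (cases v)
      from False v affine[of c a b] obtain x :: "real ^ 2" where "F v = c ^ 4 * F (x $ 1, x $ 2, 1)" by auto
      with nonneg[of x] show ?thesis by (simp add: F_affine)
    qed simp
  qed
  obtain x where "p \<bullet> monomials4 x \<noteq> 0"
    using inner_monomials4_eq_0[of p] \<open>p \<noteq> 0\<close> by blast
  then have "F (x $ 1, x $ 2, 1) \<noteq> 0" by (simp add: F_affine)
  from ternary_quartic_dominates_square[OF F F_nonneg this]
  obtain q u where q: "form 2 q" "q u \<noteq> 0" "\<And>v. (q v)\<^sup>2 \<le> F v"
    unfolding dominates_square_def by blast
  obtain w where w: "\<And>x y z. q (x, y, z) = (\<Sum>\<alpha>\<in>UNIV. w $ \<alpha> * (x ^ fst (exps \<alpha>) * y ^ snd (exps \<alpha>) * z ^ (2 - fst (exps \<alpha>) - snd (exps \<alpha>))))"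
    using quadratic_form_coefficients[OF q(1)] by blast
  show thesis
  proof (rule that)
    show "w \<noteq> 0"
    proof
      assume "w = 0"
      with w[of "fst u" "fst (snd u)" "snd (snd u)"] q(2) show False by simp
    qed
    show "(w \<bullet> monomials2 x)\<^sup>2 \<le> p \<bullet> monomials4 x" for x
    proof -
      have "q (x $ 1, x $ 2, 1) = w \<bullet> monomials2 x"
        by (simp add: w inner_vec_def monomials2_def monomial_def)
      with q(3)[of "(x $ 1, x $ 2, 1)"] show ?thesis by (simp add: F_affine)
    qed
  qed
qed

section \<open>From squares to nonnegative polynomials\<close>

lemma span_monomials4: "span (range monomials4) = UNIV"
proof (rule ccontr)
  assume "span (range monomials4) \<noteq> UNIV"
  from span_not_UNIV_orthogonal[OF this] obtain a
    where "a \<noteq> 0" "\<And>u. u \<in> span (range monomials4) \<Longrightarrow> a \<bullet> u = 0" by blast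
  moreover from this(2) have "a \<bullet> monomials4 x = 0" for x by (simp add: span_base)
  ultimately show False using inner_monomials4_eq_0 by blast
qed

text \<open>
  The interval from \<open>0\<close> to \<open>p\<close> in the order of pointwise comparison on the plane.
\<close>

definition nonneg_below :: "real ^ midx4 \<Rightarrow> (real ^ midx4) set" where
  "nonneg_below p = {r. \<forall>x. 0 \<le> r \<bullet> monomials4 x \<and> r \<bullet> monomials4 x \<le> p \<bullet> monomials4 x}"

text \<open>
  Evaluation functionals are bounded on the interval, and they span the dual space.
\<close>

lemma compact_nonneg_below: "compact (nonneg_below p)"
proof -
  have "nonneg_below p = (\<Inter>x. {r. 0 \<le> r \<bullet> monomials4 x} \<inter> {r. r \<bullet> monomials4 x \<le> p \<bullet> monomials4 x})"
    by (auto simp: nonneg_below_def)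
  also have "closed \<dots>"
    by (intro closed_INT closed_Int closed_Collect_le continuous_intros ballI)
  finally have "closed (nonneg_below p)" .
  have "\<forall>u. \<exists>B. \<forall>r\<in>nonneg_below p. \<bar>r \<bullet> u\<bar> \<le> B"
  proof
    fix u
    have "u \<in> span (range monomials4)" by (simp add: span_monomials4)
    then show "\<exists>B. \<forall>r\<in>nonneg_below p. \<bar>r \<bullet> u\<bar> \<le> B"
    proof (induction rule: span_induct_alt)
      case base
      show ?case by auto
    next
      case (step c u v)
      then obtain x B where u: "u = monomials4 x" and v: "\<And>r. r \<in> nonneg_below p \<Longrightarrow> \<bar>r \<bullet> v\<bar> \<le> B" by blast
      have "\<bar>r \<bullet> (c *\<^sub>R u + v)\<bar> \<le> \<bar>c\<bar> * (p \<bullet> monomials4 x) + B" if r: "r \<in> nonneg_below p" for r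
      proof -
        have "\<bar>r \<bullet> (c *\<^sub>R u + v)\<bar> \<le> \<bar>c\<bar> * \<bar>r \<bullet> u\<bar> + \<bar>r \<bullet> v\<bar>"
          using abs_triangle_ineq[of "c * (r \<bullet> u)" "r \<bullet> v"] by (simp add: inner_add_right abs_mult)
        also have "\<dots> \<le> \<bar>c\<bar> * (p \<bullet> monomials4 x) + B"
          using r by (intro add_mono mult_left_mono v) (auto simp: nonneg_below_def u)
        finally show ?thesis .
      qed
      then show ?case by blast
    qed
  qed
  from choice[OF this] obtain B where B: "\<And>u r. r \<in> nonneg_below p \<Longrightarrow> \<bar>r \<bullet> u\<bar> \<le> B u" by blast
  have "norm r \<le> (\<Sum>b\<in>Basis. B b)" if "r \<in> nonneg_below p" for r
    by (rule order_trans[OF norm_le_l1]) (intro sum_mono B that)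
  then have "bounded (nonneg_below p)" unfolding bounded_iff by blast
  with \<open>closed (nonneg_below p)\<close> show ?thesis by (simp add: compact_eq_bounded_closed)
qed

text \<open>
  Minimise over the interval below \<open>p\<close>; subtracting a dominated square from a nonzero element stays in
  the interval and lowers the functional.
\<close>

lemma positive_on_squares_imp_positive_on_nonneg:
  assumes pos: "\<And>w. w \<noteq> 0 \<Longrightarrow> 0 < poly_square w \<bullet> Y"
    and p: "\<And>x. 0 \<le> p \<bullet> monomials4 x" "p \<noteq> 0"
  shows "0 < p \<bullet> Y"
proof (rule ccontr)
  assume "\<not> 0 < p \<bullet> Y"
  then have le: "p \<bullet> Y \<le> 0" by simp
  have pK: "p \<in> nonneg_below p" using p(1) by (simp add: nonneg_below_def)
  then have "nonneg_below p \<noteq> {}" by blast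
  moreover have "continuous_on (nonneg_below p) (\<lambda>r. r \<bullet> Y)" by (intro continuous_intros)
  ultimately obtain r where r: "r \<in> nonneg_below p" "\<And>s. s \<in> nonneg_below p \<Longrightarrow> r \<bullet> Y \<le> s \<bullet> Y"
    using continuous_attains_inf[OF compact_nonneg_below] by blast
  have reduce: "\<exists>t\<in>nonneg_below p. t \<bullet> Y < s \<bullet> Y" if "s \<in> nonneg_below p" "s \<noteq> 0" for s
  proof -
    have s: "0 \<le> s \<bullet> monomials4 x" "s \<bullet> monomials4 x \<le> p \<bullet> monomials4 x" for x
      using that(1) by (simp_all add: nonneg_below_def)
    from nonneg_quartic_ge_square[OF s(1) that(2)] obtain w
      where w: "w \<noteq> 0" "\<And>x. (w \<bullet> monomials2 x)\<^sup>2 \<le> s \<bullet> monomials4 x" by blast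
    have e: "(s - poly_square w) \<bullet> monomials4 x = s \<bullet> monomials4 x - (w \<bullet> monomials2 x)\<^sup>2" for x
      by (simp add: inner_diff_left poly_square_monomials4)
    have "0 \<le> (s - poly_square w) \<bullet> monomials4 x" for x
      using e[of x] w(2)[of x] by linarith
    moreover have "(s - poly_square w) \<bullet> monomials4 x \<le> p \<bullet> monomials4 x" for x
      using e[of x] s(2)[of x] zero_le_power2[of "w \<bullet> monomials2 x"] by linarith
    ultimately have "s - poly_square w \<in> nonneg_below p" by (simp add: nonneg_below_def)
    moreover have "(s - poly_square w) \<bullet> Y < s \<bullet> Y"
      using pos[OF w(1)] by (simp add: inner_diff_left)
    ultimately show ?thesis by blast
  qed
  show False
  proof (cases "r = 0")
    case True
    from reduce[OF pK p(2)] obtain t where "t \<in> nonneg_below p" "t \<bullet> Y < p \<bullet> Y" by blast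
    with r(2)[of t] le True show False by simp
  next
    case False
    from reduce[OF r(1) this] obtain t where "t \<in> nonneg_below p" "t \<bullet> Y < r \<bullet> Y" by blast
    with r(2)[of t] show False by simp
  qed
qed

section \<open>Representing measures\<close>

text \<open>
  Separate \<open>Y\<close> from the cone. A linear functional bounded below on a cone is nonnegative there, so the
  separating vector is a nonnegative polynomial.
\<close>

lemma positive_on_nonneg_imp_in_cone:
  assumes pos: "\<And>p. (\<And>x. 0 \<le> p \<bullet> monomials4 x) \<Longrightarrow> p \<noteq> 0 \<Longrightarrow> 0 < p \<bullet> Y"
  shows "Y \<in> convex_cone hull (range monomials4)"
proof (rule ccontr)
  let ?C = "convex_cone hull (range monomials4)"
  assume "Y \<notin> ?C"
  then have "{Y} \<inter> ?C = {}" by simp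
  from separating_hyperplane_sets[OF convex_singleton convex_convex_cone_hull _ convex_cone_hull_nonempty this]
  obtain a b where a: "a \<noteq> 0" "a \<bullet> Y \<le> b" "\<And>u. u \<in> ?C \<Longrightarrow> b \<le> a \<bullet> u" by auto
  have b: "b \<le> 0" using a(3)[OF convex_cone_hull_contains_0] by simp
  have "0 \<le> a \<bullet> monomials4 x" for x
  proof (rule ccontr)
    assume neg: "\<not> 0 \<le> a \<bullet> monomials4 x"
    define t where "t = (b - 1) / (a \<bullet> monomials4 x)"
    have "0 \<le> t" using neg b by (simp add: t_def divide_nonpos_neg)
    then have "t *\<^sub>R monomials4 x \<in> ?C"
      by (intro convex_cone_hull_mul hull_inc) auto
    from a(3)[OF this] neg show False by (simp add: t_def)
  qed
  from pos[OF this a(1)] a(2) b show False by simp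
qed

lemma cone_of_monomials_atoms:
  assumes "Y \<in> convex_cone hull (range monomials4)"
  obtains A c where "finite A" "\<And>x. x \<in> A \<Longrightarrow> 0 \<le> c x" "Y = (\<Sum>x\<in>A. c x *\<^sub>R monomials4 x)"
proof -
  obtain u t where u: "u \<in> convex hull (range monomials4)" "0 \<le> t" "Y = t *\<^sub>R u"
    using assms by (auto simp: convex_cone_hull_convex_hull_nonempty)
  from u(1) obtain S f where S: "finite S" "S \<subseteq> range monomials4" "\<forall>v\<in>S. 0 \<le> f v" "(\<Sum>v\<in>S. f v *\<^sub>R v) = u"
    unfolding convex_hull_explicit by blast
  from S(2) obtain A where A: "inj_on monomials4 A" "S = monomials4 ` A"
    unfolding subset_image_inj by blast
  show thesis
  proof (rule that[of A "\<lambda>x. t * f (monomials4 x)"])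
    show "finite A" using S(1) A finite_imageD by blast
    show "0 \<le> t * f (monomials4 x)" if "x \<in> A" for x using that S(3) A(2) u(2) by simp
    show "Y = (\<Sum>x\<in>A. (t * f (monomials4 x)) *\<^sub>R monomials4 x)"
      using S(4) A unfolding u(3) by (auto simp: sum.reindex scaleR_sum_right)
  qed
qed

lemma finite_atomic_representing_measure:
  fixes A :: "(real ^ 2) set"
  assumes "finite A" and c: "\<And>x. x \<in> A \<Longrightarrow> 0 \<le> c x"
    and Y: "\<And>i j. i + j \<le> 4 \<Longrightarrow> y (i, j) = (\<Sum>x\<in>A. c x * ((x $ 1) ^ i * (x $ 2) ^ j))"
  shows "representing_measure4 y (distr (point_measure A c) borel (\<lambda>x. x))"
proof -
  have meas: "(\<lambda>x. x) \<in> measurable (point_measure A c) borel" by simp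
  have cont: "(\<lambda>x::real^2. (x $ 1) ^ i * (x $ 2) ^ j) \<in> borel_measurable borel" for i j
    by (intro borel_measurable_continuous_onI continuous_intros)
  show ?thesis
    unfolding representing_measure4_def
    using assms
    by (simp add: integral_distr[OF meas cont] integrable_distr_eq[OF meas cont]
       integrable_point_measure_finite lebesgue_integral_point_measure_finite)
qed

theorem theorem3p3:
  fixes y :: "nat \<times> nat \<Rightarrow> real"
  assumes "positive_definite (moment_matrix2 y)"
  shows "\<exists>\<mu>. representing_measure4 y \<mu>"
proof -
  define Y :: "real ^ midx4" where "Y = (\<chi> \<gamma>. y (exps4 \<gamma>))"
  have pos: "0 < poly_square w \<bullet> Y" if "w \<noteq> 0" for w
    using assms that unfolding Y_def poly_square_moments positive_definite_def by blast
  have "Y \<in> convex_cone hull (range monomials4)"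
    by (rule positive_on_nonneg_imp_in_cone) (rule positive_on_squares_imp_positive_on_nonneg[OF pos])
  then obtain A c where A: "finite A" "\<And>x. x \<in> A \<Longrightarrow> 0 \<le> c x" "Y = (\<Sum>x\<in>A. c x *\<^sub>R monomials4 x)"
    using cone_of_monomials_atoms by blast
  have "y (i, j) = (\<Sum>x\<in>A. c x * ((x $ 1) ^ i * (x $ 2) ^ j))" if "i + j \<le> 4" for i j
  proof -
    have "exps4 (Abs_midx4 (i, j)) = (i, j)" using that by (simp add: Abs_midx4_inverse)
    then have "y (i, j) = Y $ Abs_midx4 (i, j)" by (simp add: Y_def)
    also have "\<dots> = (\<Sum>x\<in>A. c x * ((x $ 1) ^ i * (x $ 2) ^ j))"
      using \<open>exps4 _ = _\<close> by (simp add: A(3) monomials4_def monomial_def)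
    finally show ?thesis .
  qed
  from finite_atomic_representing_measure[OF A(1,2) this] show ?thesis by blast
qed

end
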